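(* Let $R$ be a commutative Artinian ring with nonzero identity and let $M$ be a unital $R$-module such that $AG(M)$ is a bipartite graph. Then either $AG(M)$ is a star graph or $AG(M)\cong P_4$. Moreover, $AG(M)\cong P_4$ if and only if $M=F\times S$, where $F$ is a simple module and $S$ is a module with a unique non-trivial submodule.
   Context: For a submodule $N\leq M$, $(N:M)=\{r\in R : rM\subseteq N\}$ and $Ann(M)=((0):M)$. The product of submodules $N,K\leq M$ is $NK:=(N:M)(K:M)M$. The annihilating-submodule graph $AG(M)$ is the undirected graph whose vertices are the nonzero submodules $N$ of $M$ (possibly $N=M$) for which there exists a nonzero proper submodule $K$ of $M$ with $NK=(0)$; two distinct vertices $N,K$ are adjacent if and only if $NK=(0)$. A graph has, by convention, a nonempty vertex set, so saying that $AG(M)$ is a graph of some kind presupposes that it has at least one vertex. A graph is bipartite if its vertex set can be divided into two disjoint independent sets. A star graph is a complete bipartite graph $K_{1,m}$, where $m$ may be any cardinal (a single vertex counts as $K_{1,0}$). $P_4$ is the path on $4$ vertices. A non-trivial submodule of a module is a nonzero proper submodule. *)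

theory Defs
  imports
    "Graph_Theory.Pair_Digraph"
    "Graph_Theory.Digraph_Isomorphism"
    "HOL-Algebra.Module"
    "HOL-Algebra.Ideal_Product"
begin

section \<open>Graphs\<close>

text \<open>
  As in the Graph_Theory library, an undirected graph is a symmetric digraph; an edge
  between \<open>u\<close> and \<open>v\<close> is the pair of arcs \<open>(u, v)\<close> and \<open>(v, u)\<close>. The vertex set may be infinite.
\<close>

definition independent_set :: "'a pair_pre_digraph \<Rightarrow> 'a set \<Rightarrow> bool" where
  "independent_set G U \<longleftrightarrow> U \<subseteq> pverts G \<and> (\<forall>u\<in>U. \<forall>v\<in>U. (u, v) \<notin> parcs G)"

text \<open>A part may be empty, so that a single vertex is bipartite.\<close>

definition bipartite :: "'a pair_pre_digraph \<Rightarrow> bool" where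
  "bipartite G \<longleftrightarrow>
     (\<exists>U V. pverts G = U \<union> V \<and> U \<inter> V = {} \<and> independent_set G U \<and> independent_set G V)"

definition complete_bipartite_with_parts :: "'a set \<Rightarrow> 'a set \<Rightarrow> 'a pair_pre_digraph \<Rightarrow> bool" where
  "complete_bipartite_with_parts U V G \<longleftrightarrow>
     pverts G = U \<union> V \<and> U \<inter> V = {} \<and> parcs G = U \<times> V \<union> V \<times> U"

text \<open>\<open>V\<close> may be infinite, or empty (a single vertex).\<close>

definition star_graph :: "'a pair_pre_digraph \<Rightarrow> bool" where
  "star_graph G \<longleftrightarrow> (\<exists>c V. complete_bipartite_with_parts {c} V G)"

definition path_graph :: "nat \<Rightarrow> nat pair_pre_digraph" where
  "path_graph n =
     \<lparr> pverts = {..<n}, parcs = {(i, j). i < n \<and> j < n \<and> (j = Suc i \<or> i = Suc j)} \<rparr>"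

section \<open>Rings and modules\<close>

locale artinian_cring = cring +
  assumes descending_chain_condition:
    "\<And>I :: nat \<Rightarrow> 'a set. (\<And>i. ideal (I i) R) \<Longrightarrow> (\<And>i. I (Suc i) \<subseteq> I i)
       \<Longrightarrow> \<exists>n. \<forall>k\<ge>n. I k = I n"

definition nontrivial_submodule ::
    "'c set \<Rightarrow> ('a, 'b) ring_scheme \<Rightarrow> ('a, 'c, 'd) module_scheme \<Rightarrow> bool" where
  "nontrivial_submodule N R M \<longleftrightarrow> submodule N R M \<and> N \<noteq> {\<zero>\<^bsub>M\<^esub>} \<and> N \<noteq> carrier M"

definition simple_module :: "('a, 'b) ring_scheme \<Rightarrow> ('a, 'c, 'd) module_scheme \<Rightarrow> bool" where
  "simple_module R M \<longleftrightarrow> Module.module R M \<and> carrier M \<noteq> {\<zero>\<^bsub>M\<^esub>} \<and>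
     (\<forall>N. submodule N R M \<longrightarrow> N = {\<zero>\<^bsub>M\<^esub>} \<or> N = carrier M)"

text \<open>
  The fields \<open>mult\<close> and \<open>one\<close>, which the module record inherits from the ring record, play no
  role in a module.
\<close>

definition module_DirProd ::
    "('a, 'b, 'm) module_scheme \<Rightarrow> ('a, 'c, 'n) module_scheme \<Rightarrow> ('a, 'b \<times> 'c) module" where
  "module_DirProd F S =
     \<lparr> carrier = carrier F \<times> carrier S,
       mult = (\<lambda>(x, y) (x', y'). (x \<otimes>\<^bsub>F\<^esub> x', y \<otimes>\<^bsub>S\<^esub> y')),
       one = (\<one>\<^bsub>F\<^esub>, \<one>\<^bsub>S\<^esub>),
       zero = (\<zero>\<^bsub>F\<^esub>, \<zero>\<^bsub>S\<^esub>),
       add = (\<lambda>(x, y) (x', y'). (x \<oplus>\<^bsub>F\<^esub> x', y \<oplus>\<^bsub>S\<^esub> y')),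
       smult = (\<lambda>a (x, y). (a \<odot>\<^bsub>F\<^esub> x, a \<odot>\<^bsub>S\<^esub> y)) \<rparr>"

definition module_isomorphic ::
    "('a, 'r) ring_scheme \<Rightarrow> ('a, 'b, 'm) module_scheme \<Rightarrow> ('a, 'c, 'n) module_scheme \<Rightarrow> bool" where
  "module_isomorphic R M N \<longleftrightarrow>
     (\<exists>h \<in> iso (add_monoid M) (add_monoid N).
        \<forall>a\<in>carrier R. \<forall>x\<in>carrier M. h (a \<odot>\<^bsub>M\<^esub> x) = a \<odot>\<^bsub>N\<^esub> h x)"

section \<open>The annihilating-submodule graph\<close>

text \<open>\<open>(N : M)\<close>\<close>

definition residual ::
    "('a, 'b) ring_scheme \<Rightarrow> ('a, 'c, 'd) module_scheme \<Rightarrow> 'c set \<Rightarrow> 'a set" where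
  "residual R M N = {r \<in> carrier R. \<forall>x\<in>carrier M. r \<odot>\<^bsub>M\<^esub> x \<in> N}"

text \<open>
  \<open>IM\<close>, the set of finite sums of products, defined in the same way as \<^const>\<open>ideal_prod\<close>. For an
  ideal \<open>I\<close> it is a submodule: it contains zero because \<open>I\<close> does.
\<close>

inductive_set ideal_smult :: "('a, 'c, 'd) module_scheme \<Rightarrow> 'a set \<Rightarrow> 'c set"
  for M and I where
    smult: "\<lbrakk> i \<in> I; x \<in> carrier M \<rbrakk> \<Longrightarrow> i \<odot>\<^bsub>M\<^esub> x \<in> ideal_smult M I"
  | sum: "\<lbrakk> s \<in> ideal_smult M I; t \<in> ideal_smult M I \<rbrakk> \<Longrightarrow> s \<oplus>\<^bsub>M\<^esub> t \<in> ideal_smult M I"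

definition submodule_prod ::
    "('a, 'b) ring_scheme \<Rightarrow> ('a, 'c, 'd) module_scheme \<Rightarrow> 'c set \<Rightarrow> 'c set \<Rightarrow> 'c set" where
  "submodule_prod R M N K = ideal_smult M (ideal_prod R (residual R M N) (residual R M K))"

definition AG_verts :: "('a, 'b) ring_scheme \<Rightarrow> ('a, 'c, 'd) module_scheme \<Rightarrow> 'c set set" where
  "AG_verts R M = {N. submodule N R M \<and> N \<noteq> {\<zero>\<^bsub>M\<^esub>} \<and>
     (\<exists>K. nontrivial_submodule K R M \<and> submodule_prod R M N K = {\<zero>\<^bsub>M\<^esub>})}"

definition AG :: "('a, 'b) ring_scheme \<Rightarrow> ('a, 'c, 'd) module_scheme \<Rightarrow> 'c set pair_pre_digraph" where
  "AG R M =
     \<lparr> pverts = AG_verts R M,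
       parcs = {(N, K). N \<in> AG_verts R M \<and> K \<in> AG_verts R M \<and> N \<noteq> K \<and>
                        submodule_prod R M N K = {\<zero>\<^bsub>M\<^esub>}} \<rparr>"

end

theory Submission
  imports Defs
begin

text \<open>
  Only two consequences of bipartiteness matter: three distinct nonzero submodules cannot have pairwise
  zero products, and a triangle-free graph with a vertex adjacent to all others is a star. A product
  \<open>NK\<close> vanishes exactly when \<open>ab\<close> kills \<open>M\<close> for all \<open>a \<in> (N : M)\<close> and \<open>b \<in> (K : M)\<close>, so everything
  is decided by elements of the ring. In particular \<open>NK = 0\<close> whenever \<open>N \<inter> K = 0\<close>, and \<open>aM\<close> and \<open>bM\<close>
  have product zero whenever \<open>ab\<close> kills \<open>M\<close>.

  The structure theory of Artinian rings is replaced by two applications of the chain condition to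
  principal ideals. First, some power of each element is a multiple of its own square, and so
  yields an idempotent; hence on a block \<open>gM\<close>, with \<open>g\<close> an idempotent that cannot be split on \<open>M\<close>,
  each ring element is nilpotent or invertible. Secondly, among the multiples of \<open>g\<close> that do not kill
  \<open>M\<close> there is one, \<open>b\<close>, whose principal ideal is as small as possible; \<open>bM\<close> serves as a socle of the block. If
  \<open>a \<in> (L : M)\<close> for a submodule \<open>L\<close> that does not contain \<open>gM\<close>, then \<open>a\<close> is not invertible on \<open>gM\<close>, and so
  \<open>ab\<close> kills \<open>M\<close>. Thus \<open>bM\<close> has product zero with every such \<open>L\<close> (\<open>ex_socle_generator\<close>, \<open>orth_socle\<close>).

  If \<open>1\<close> cannot be split, \<open>bM\<close> has product zero with every proper submodule. It is itself proper,
  because otherwise \<open>(N : M)M = 0\<close> for every proper \<open>N\<close>, which produces a triangle. So the graph is a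
  star (\<open>star_graph_if_one_primitive\<close>); the centre is \<open>bM\<close> unless \<open>M\<close> itself is a vertex.

  If \<open>1\<close> splits as \<open>e + f\<close>, then neither \<open>e\<close> nor \<open>f\<close> splits further, since three orthogonal
  idempotents give a triangle. Each of \<open>eM\<close> and \<open>fM\<close> is simple or has a socle \<open>bM\<close> that is proper in
  it (\<open>block_simple_or_proper_socle\<close>), and two proper socles \<open>bM\<close>, \<open>cM\<close> would form a triangle with
  \<open>(b + c)M\<close>. If both blocks are simple, they are the only non-trivial submodules and the graph is an
  edge. If \<open>eM\<close> is simple and \<open>bM\<close> is proper in \<open>fM\<close>, then \<open>bM\<close> is the only non-trivial
  submodule of \<open>fM\<close>, because another one would form a triangle with \<open>bM\<close> and \<open>eM\<close>. The graph is then
  the path with successive vertices \<open>fM\<close>, \<open>eM\<close>, \<open>bM\<close>, \<open>eM + bM\<close>, and \<open>M = eM \<times> fM\<close> is the required product.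

  Conversely, a product of a simple module and a module with a unique non-trivial submodule gives
  \<open>M = F + S\<close> with \<open>F \<inter> S = 0\<close> and a non-trivial submodule \<open>N\<close> of \<open>S\<close>. This is impossible in the two
  cases in which the graph is a star, and a star is never the path on four vertices.
\<close>

section \<open>Stars and the path on four vertices\<close>

lemma digraph_iso_path_4I:
  assumes "pverts G = {p, q, r, s}" "distinct [p, q, r, s]"
    and "parcs G = {(p, q), (q, p), (q, r), (r, q), (r, s), (s, r)}"
  shows "digraph_iso (with_proj G) (with_proj (path_graph 4))"
proof -
  define h where "h v = (if v = p then 0 else if v = q then 1 else if v = r then 2 else 3::nat)" for v
  define hom where "hom = \<lparr>iso_verts = h, iso_arcs = map_prod h h, iso_head = snd, iso_tail = fst\<rparr>"
  have h: "h p = 0" "h q = 1" "h r = 2" "h s = 3" using assms(2) by (auto simp: h_def)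
  have inj: "inj_on h (pverts G)" unfolding assms(1) by (auto simp: inj_on_def h)
  have sub: "parcs G \<subseteq> pverts G \<times> pverts G" unfolding assms(1,3) by auto
  have "wf_digraph (with_proj G)" using sub by unfold_locales auto
  moreover have "inj_on (map_prod h h) (parcs G)"
    using map_prod_inj_on[OF inj inj] sub inj_on_subset by blast
  ultimately have "pre_digraph.digraph_isomorphism (with_proj G) hom"
    using inj by (auto simp: pre_digraph.digraph_isomorphism_def hom_def)
  moreover have "pverts (path_graph 4) = {0, 1, 2, 3}"
    by (auto simp: path_graph_def)
  moreover have "parcs (path_graph 4) = {(0, 1), (1, 0), (1, 2), (2, 1), (2, 3), (3, 2)}"
    by (auto simp: path_graph_def)
  ultimately have "pre_digraph.digraph_isomorphism (with_proj G) hom \<and>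
      with_proj (path_graph 4) = app_iso hom (with_proj G)"
    by (simp add: with_proj_def app_iso_def hom_def assms(1,3) h)
  then show ?thesis unfolding digraph_iso_def by blast
qed

text \<open>
  The centre of a star is adjacent to all other vertices, whereas each vertex of the path has a
  vertex at distance at least two: \<open>3\<close> for the first two vertices and \<open>0\<close> for the last two.
\<close>

lemma star_graph_not_iso_path_4:
  assumes "star_graph G" shows "\<not> digraph_iso (with_proj G) (with_proj (path_graph 4))"
proof
  assume "digraph_iso (with_proj G) (with_proj (path_graph 4))"
  then obtain h where h: "pre_digraph.digraph_isomorphism (with_proj G) h"
    and eq: "with_proj (path_graph 4) = app_iso h (with_proj G)"
    unfolding digraph_iso_def by blast
  have verts: "{..<4} = iso_verts h ` pverts G" and arcs: "parcs (path_graph 4) = iso_arcs h ` parcs G"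
    and proj: "fst = iso_tail h" "snd = iso_head h"
    using eq by (auto simp: with_proj_def app_iso_def path_graph_def)
  have arc: "(iso_verts h u, iso_verts h v) \<in> parcs (path_graph 4)" if "(u, v) \<in> parcs G" for u v
  proof -
    have "iso_verts h u = fst (iso_arcs h (u, v))" "iso_verts h v = snd (iso_arcs h (u, v))"
      using h that unfolding pre_digraph.digraph_isomorphism_def proj by auto
    then have "(iso_verts h u, iso_verts h v) = iso_arcs h (u, v)" by simp
    then show ?thesis using arcs that by auto
  qed
  obtain c V where cV: "pverts G = {c} \<union> V" "parcs G = {c} \<times> V \<union> V \<times> {c}"
    using assms unfolding star_graph_def complete_bipartite_with_parts_def by blast
  have adj: "(iso_verts h c, j) \<in> parcs (path_graph 4)" if j: "j < 4" "j \<noteq> iso_verts h c" for j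
  proof -
    have "j \<in> iso_verts h ` pverts G" using j(1) verts by auto
    then obtain v where "v \<in> V" "j = iso_verts h v" using j(2) cV(1) by auto
    then show ?thesis using arc cV(2) by auto
  qed
  have "iso_verts h c < 4" using verts cV(1) by auto
  then consider "iso_verts h c \<le> 1" | "iso_verts h c \<ge> 2" by linarith
  then show False
  proof cases
    case 1 then show ?thesis using adj[of 3] by (auto simp: path_graph_def)
  next
    case 2 then show ?thesis using adj[of 0] by (auto simp: path_graph_def)
  qed
qed

section \<open>Submodules and the vanishing of their products\<close>

text \<open>
  Closure under inverses is automatic, since \<open>- x = (- 1) x\<close>.
\<close>

lemma (in module) submodule_iff:
  "submodule H R M \<longleftrightarrow> H \<subseteq> carrier M \<and> \<zero>\<^bsub>M\<^esub> \<in> H \<and>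
     (\<forall>x\<in>H. \<forall>y\<in>H. x \<oplus>\<^bsub>M\<^esub> y \<in> H) \<and> (\<forall>a\<in>carrier R. \<forall>x\<in>H. a \<odot>\<^bsub>M\<^esub> x \<in> H)"
proof
  assume "submodule H R M"
  then show "H \<subseteq> carrier M \<and> \<zero>\<^bsub>M\<^esub> \<in> H \<and>
     (\<forall>x\<in>H. \<forall>y\<in>H. x \<oplus>\<^bsub>M\<^esub> y \<in> H) \<and> (\<forall>a\<in>carrier R. \<forall>x\<in>H. a \<odot>\<^bsub>M\<^esub> x \<in> H)"
    using submoduleE submodule.axioms(1) subgroup.one_closed by fastforce
next
  assume H: "H \<subseteq> carrier M \<and> \<zero>\<^bsub>M\<^esub> \<in> H \<and>
     (\<forall>x\<in>H. \<forall>y\<in>H. x \<oplus>\<^bsub>M\<^esub> y \<in> H) \<and> (\<forall>a\<in>carrier R. \<forall>x\<in>H. a \<odot>\<^bsub>M\<^esub> x \<in> H)"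
  have "\<ominus>\<^bsub>M\<^esub> x = (\<ominus> \<one>) \<odot>\<^bsub>M\<^esub> x" if "x \<in> H" for x
    using H that by (subst smult_l_minus) auto
  then show "submodule H R M" using H by (intro submoduleI) auto
qed

context module
begin

definition Ann where
  "Ann = {a \<in> carrier R. \<forall>x\<in>carrier M. a \<odot>\<^bsub>M\<^esub> x = \<zero>\<^bsub>M\<^esub>}"

definition smult_range where
  "smult_range a = (\<lambda>x. a \<odot>\<^bsub>M\<^esub> x) ` carrier M"

abbreviation submod where
  "submod N \<equiv> submodule N R M"

abbreviation res where
  "res N \<equiv> residual R M N"

abbreviation orth where
  "orth N K \<equiv> submodule_prod R M N K = {\<zero>\<^bsub>M\<^esub>}"

lemma Ann_I: "a \<in> carrier R \<Longrightarrow> (\<And>x. x \<in> carrier M \<Longrightarrow> a \<odot>\<^bsub>M\<^esub> x = \<zero>\<^bsub>M\<^esub>) \<Longrightarrow> a \<in> Ann"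
  by (simp add: Ann_def)

lemma Ann_D: "a \<in> Ann \<Longrightarrow> x \<in> carrier M \<Longrightarrow> a \<odot>\<^bsub>M\<^esub> x = \<zero>\<^bsub>M\<^esub>"
  by (simp add: Ann_def)

lemma Ann_carrier: "a \<in> Ann \<Longrightarrow> a \<in> carrier R"
  by (simp add: Ann_def)

lemma Ann_mult_l: "a \<in> Ann \<Longrightarrow> r \<in> carrier R \<Longrightarrow> r \<otimes> a \<in> Ann"
  by (simp add: Ann_def smult_assoc1)

lemma smult_commute:
  "\<lbrakk>a \<in> carrier R; b \<in> carrier R; x \<in> carrier M\<rbrakk>
    \<Longrightarrow> a \<odot>\<^bsub>M\<^esub> (b \<odot>\<^bsub>M\<^esub> x) = b \<odot>\<^bsub>M\<^esub> (a \<odot>\<^bsub>M\<^esub> x)"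
  by (metis smult_assoc1 R.m_comm)

lemma submod_zero: "submod N \<Longrightarrow> \<zero>\<^bsub>M\<^esub> \<in> N"
  by (simp add: submodule_iff)

lemma submod_subset: "submod N \<Longrightarrow> x \<in> N \<Longrightarrow> x \<in> carrier M"
  using submoduleE(1) by blast

lemma submod_of_zero: "submod {\<zero>\<^bsub>M\<^esub>}"
  by (simp add: submodule_iff)

lemma submod_Int: "submod N \<Longrightarrow> submod K \<Longrightarrow> submod (N \<inter> K)"
  by (rule submoduleI) (auto simp: submodule.smult_closed submoduleE submod_zero submod_subset)

lemma res_carrier: "a \<in> res N \<Longrightarrow> a \<in> carrier R"
  by (simp add: residual_def)

lemma res_D: "a \<in> res N \<Longrightarrow> x \<in> carrier M \<Longrightarrow> a \<odot>\<^bsub>M\<^esub> x \<in> N"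
  by (simp add: residual_def)

lemma zero_in_res: "submod N \<Longrightarrow> \<zero> \<in> res N"
  by (simp add: residual_def submod_zero)

lemma one_in_res_carrier: "\<one> \<in> res (carrier M)"
  by (simp add: residual_def)

lemma submod_smult_range:
  assumes "a \<in> carrier R" shows "submod (smult_range a)"
  unfolding submodule_iff smult_range_def
proof (intro conjI ballI)
  show "\<zero>\<^bsub>M\<^esub> \<in> (\<lambda>x. a \<odot>\<^bsub>M\<^esub> x) ` carrier M"
    using assms by (intro image_eqI[of _ _ "\<zero>\<^bsub>M\<^esub>"]) auto
qed (use assms in \<open>auto simp: smult_commute[of _ a] simp flip: smult_r_distr\<close>)

lemma smult_range_zero_iff: "a \<in> carrier R \<Longrightarrow> smult_range a = {\<zero>\<^bsub>M\<^esub>} \<longleftrightarrow> a \<in> Ann"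
  unfolding smult_range_def Ann_def by force

lemma smult_range_one: "smult_range \<one> = carrier M"
  by (simp add: smult_range_def)

lemma in_res_smult_range: "a \<in> carrier R \<Longrightarrow> a \<in> res (smult_range a)"
  by (simp add: residual_def smult_range_def)

text \<open>
  The vanishing of \<open>NK = (N : M)(K : M)M\<close> can be tested on the products of one element from each
  residual, because these generate the ideal \<open>(N : M)(K : M)\<close>.
\<close>

lemma orth_iff:
  assumes "submod N" "submod K"
  shows "orth N K \<longleftrightarrow> (\<forall>a\<in>res N. \<forall>b\<in>res K. a \<otimes> b \<in> Ann)"
proof
  assume prod: "orth N K"
  show "\<forall>a\<in>res N. \<forall>b\<in>res K. a \<otimes> b \<in> Ann"
  proof (intro ballI Ann_I)
    fix a b x assume "a \<in> res N" "b \<in> res K" "x \<in> carrier M"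
    then have "(a \<otimes> b) \<odot>\<^bsub>M\<^esub> x \<in> submodule_prod R M N K"
      unfolding submodule_prod_def by (intro ideal_smult.smult ideal_prod.prod)
    then show "(a \<otimes> b) \<odot>\<^bsub>M\<^esub> x = \<zero>\<^bsub>M\<^esub>" using prod by simp
  qed (auto dest: res_carrier)
next
  assume kill: "\<forall>a\<in>res N. \<forall>b\<in>res K. a \<otimes> b \<in> Ann"
  have Ann: "i \<in> Ann" if "i \<in> ideal_prod R (res N) (res K)" for i
    using that
  proof induction
    case (sum i j)
    then show ?case by (auto simp: Ann_def smult_l_distr)
  qed (use kill in auto)
  have "x = \<zero>\<^bsub>M\<^esub>" if "x \<in> submodule_prod R M N K" for x
    using that unfolding submodule_prod_def by induction (auto dest: Ann Ann_D)
  moreover have "\<zero>\<^bsub>M\<^esub> \<in> submodule_prod R M N K"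
  proof -
    have "\<zero> \<otimes> \<zero> \<in> ideal_prod R (res N) (res K)"
      using assms by (intro ideal_prod.prod zero_in_res)
    then show ?thesis
      unfolding submodule_prod_def by (metis R.l_null R.zero_closed M.zero_closed ideal_smult.smult smult_r_null)
  qed
  ultimately show "orth N K" by blast
qed

lemma orth_sym: "\<lbrakk>submod N; submod K; orth N K\<rbrakk> \<Longrightarrow> orth K N"
  by (simp add: orth_iff) (metis res_carrier R.m_comm)

lemma not_orthI:
  "\<lbrakk>submod N; submod K; a \<in> res N; b \<in> res K; a \<otimes> b \<notin> Ann\<rbrakk> \<Longrightarrow> \<not> orth N K"
  by (auto simp: orth_iff)

lemma not_orth_carrier:
  assumes "submod K" "a \<in> res K" "a \<notin> Ann" shows "\<not> orth (carrier M) K"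
  using not_orthI[OF carrier_is_submodule assms(1) one_in_res_carrier assms(2)] assms(3)
    res_carrier[OF assms(2)] by simp

text \<open>
  The product \<open>NK\<close> always lies in \<open>N \<inter> K\<close>.
\<close>

lemma orth_if_disjoint:
  assumes "submod N" "submod K" "N \<inter> K \<subseteq> {\<zero>\<^bsub>M\<^esub>}" shows "orth N K"
  unfolding orth_iff[OF assms(1,2)]
proof (intro ballI Ann_I)
  fix a b x assume ab: "a \<in> res N" "b \<in> res K" and x: "x \<in> carrier M"
  have "(a \<otimes> b) \<odot>\<^bsub>M\<^esub> x \<in> N"
    using ab x by (metis res_D res_carrier smult_assoc1 smult_closed)
  moreover have "(a \<otimes> b) \<odot>\<^bsub>M\<^esub> x \<in> K"
    using ab x by (metis R.m_comm res_D res_carrier smult_assoc1 smult_closed)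
  ultimately show "(a \<otimes> b) \<odot>\<^bsub>M\<^esub> x = \<zero>\<^bsub>M\<^esub>" using assms(3) by auto
qed (auto dest: res_carrier)

lemma orth_if_residual_in_Ann:
  assumes "submod N" "submod K" "res N \<subseteq> Ann" shows "orth N K"
  unfolding orth_iff[OF assms(1,2)] using assms(3)
  by (metis Ann_carrier Ann_mult_l R.m_comm res_carrier subsetD)

text \<open>
  An element \<open>s\<close> of \<open>(bM : M)\<close> maps \<open>M\<close> into \<open>bM\<close>, hence \<open>a s M \<subseteq> a b M\<close>. So for a submodule of the
  form \<open>bM\<close> the residual may be replaced by the single element \<open>b\<close>.
\<close>

lemma orth_smult_range:
  assumes "b \<in> carrier R" "submod L" "\<And>a. a \<in> res L \<Longrightarrow> a \<otimes> b \<in> Ann"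
  shows "orth (smult_range b) L"
  unfolding orth_iff[OF submod_smult_range[OF assms(1)] assms(2)]
proof (intro ballI Ann_I)
  fix s a x assume s: "s \<in> res (smult_range b)" and a: "a \<in> res L" and x: "x \<in> carrier M"
  note carr = res_carrier[OF s] res_carrier[OF a]
  obtain y where y: "y \<in> carrier M" "s \<odot>\<^bsub>M\<^esub> x = b \<odot>\<^bsub>M\<^esub> y"
    using res_D[OF s x] unfolding smult_range_def by blast
  have "(s \<otimes> a) \<odot>\<^bsub>M\<^esub> x = a \<odot>\<^bsub>M\<^esub> (s \<odot>\<^bsub>M\<^esub> x)"
    using carr x by (simp add: smult_assoc1 smult_commute[of s a])
  also have "\<dots> = (a \<otimes> b) \<odot>\<^bsub>M\<^esub> y"
    using carr y assms(1) by (simp add: smult_assoc1)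
  finally show "(s \<otimes> a) \<odot>\<^bsub>M\<^esub> x = \<zero>\<^bsub>M\<^esub>"
    using Ann_D[OF assms(3)[OF a] y(1)] by simp
qed (use assms(1) in \<open>auto dest: res_carrier\<close>)

lemma orth_smult_ranges:
  assumes "a \<in> carrier R" "b \<in> carrier R" "a \<otimes> b \<in> Ann"
  shows "orth (smult_range a) (smult_range b)"
proof (rule orth_smult_range[OF assms(1) submod_smult_range[OF assms(2)]])
  fix s assume s: "s \<in> res (smult_range b)"
  show "s \<otimes> a \<in> Ann"
  proof (rule Ann_I)
    fix x assume x: "x \<in> carrier M"
    obtain y where y: "y \<in> carrier M" "s \<odot>\<^bsub>M\<^esub> x = b \<odot>\<^bsub>M\<^esub> y"
      using res_D[OF s x] unfolding smult_range_def by blast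
    have "(s \<otimes> a) \<odot>\<^bsub>M\<^esub> x = a \<odot>\<^bsub>M\<^esub> (s \<odot>\<^bsub>M\<^esub> x)"
      using assms x res_carrier[OF s] by (simp add: smult_assoc1 smult_commute[of s a])
    also have "\<dots> = (a \<otimes> b) \<odot>\<^bsub>M\<^esub> y" using assms y by (simp add: smult_assoc1)
    finally show "(s \<otimes> a) \<odot>\<^bsub>M\<^esub> x = \<zero>\<^bsub>M\<^esub>" using Ann_D[OF assms(3) y(1)] by simp
  qed (use assms res_carrier[OF s] in auto)
qed

lemma smult_range_distinct:
  assumes "a \<in> carrier R" "b \<in> carrier R" "a \<otimes> a = a" "a \<notin> Ann" "a \<otimes> b \<in> Ann"
  shows "smult_range a \<noteq> smult_range b"
proof
  assume eq: "smult_range a = smult_range b"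
  have "a \<odot>\<^bsub>M\<^esub> x = \<zero>\<^bsub>M\<^esub>" if x: "x \<in> carrier M" for x
  proof -
    obtain y where y: "y \<in> carrier M" "a \<odot>\<^bsub>M\<^esub> x = b \<odot>\<^bsub>M\<^esub> y"
      using eq x unfolding smult_range_def by blast
    have "a \<odot>\<^bsub>M\<^esub> x = a \<odot>\<^bsub>M\<^esub> (a \<odot>\<^bsub>M\<^esub> x)" using assms x by (metis smult_assoc1)
    also have "\<dots> = (a \<otimes> b) \<odot>\<^bsub>M\<^esub> y" using assms y by (simp add: smult_assoc1)
    finally show ?thesis using Ann_D[OF assms(5) y(1)] by simp
  qed
  then show False using assms(1,4) Ann_I by blast
qed

end

section \<open>Triangles and stars in the annihilating-submodule graph\<close>

context module
begin

text \<open>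
  The submodules are not required to be vertices: if three distinct nonzero submodules have pairwise zero
  products, at most one of them is \<open>M\<close>, so each of them has a non-trivial partner.
\<close>

definition triangle_free :: bool where
  "triangle_free \<longleftrightarrow> (\<forall>X Y Z. submod X \<and> submod Y \<and> submod Z \<and>
     X \<noteq> {\<zero>\<^bsub>M\<^esub>} \<and> Y \<noteq> {\<zero>\<^bsub>M\<^esub>} \<and> Z \<noteq> {\<zero>\<^bsub>M\<^esub>} \<and> X \<noteq> Y \<and> X \<noteq> Z \<and> Y \<noteq> Z \<longrightarrow>
     \<not> (orth X Y \<and> orth X Z \<and> orth Y Z))"

lemma no_triangle:
  "\<lbrakk>triangle_free; submod X; submod Y; submod Z;
    X \<noteq> {\<zero>\<^bsub>M\<^esub>}; Y \<noteq> {\<zero>\<^bsub>M\<^esub>}; Z \<noteq> {\<zero>\<^bsub>M\<^esub>}; X \<noteq> Y; X \<noteq> Z; Y \<noteq> Z;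
    orth X Y; orth X Z; orth Y Z\<rbrakk> \<Longrightarrow> False"
  by (drule triangle_free_def[THEN iffD1, rule_format, of X Y Z]) simp_all

lemma AG_vertI:
  "\<lbrakk>submod N; N \<noteq> {\<zero>\<^bsub>M\<^esub>}; submod K; K \<noteq> {\<zero>\<^bsub>M\<^esub>}; K \<noteq> carrier M; orth N K\<rbrakk>
    \<Longrightarrow> N \<in> AG_verts R M"
  unfolding AG_verts_def nontrivial_submodule_def by blast

lemma nontrivial_submodule_if_AG_vert:
  assumes "N \<in> AG_verts R M" shows "\<exists>K. nontrivial_submodule K R M \<and> orth N K"
  using assms by (auto simp: AG_verts_def)

lemma triangle_free_if_bipartite:
  assumes "bipartite (AG R M)" shows triangle_free
  unfolding triangle_free_def
proof (intro allI impI notI, elim conjE)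
  fix X Y Z
  assume XYZ: "submod X" "submod Y" "submod Z"
    "X \<noteq> {\<zero>\<^bsub>M\<^esub>}" "Y \<noteq> {\<zero>\<^bsub>M\<^esub>}" "Z \<noteq> {\<zero>\<^bsub>M\<^esub>}" "X \<noteq> Y" "X \<noteq> Z" "Y \<noteq> Z"
    and orth: "orth X Y" "orth X Z" "orth Y Z"
  have orth': "orth Y X" "orth Z X" "orth Z Y"
    using orth_sym[OF XYZ(1,2) orth(1)] orth_sym[OF XYZ(1,3) orth(2)] orth_sym[OF XYZ(2,3) orth(3)]
    by simp_all
  have verts: "X \<in> AG_verts R M" "Y \<in> AG_verts R M" "Z \<in> AG_verts R M"
    using XYZ orth orth' AG_vertI by metis+
  then have arcs: "(X, Y) \<in> parcs (AG R M)" "(X, Z) \<in> parcs (AG R M)" "(Y, Z) \<in> parcs (AG R M)"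
    using XYZ orth by (auto simp: AG_def)
  obtain U V where UV: "pverts (AG R M) = U \<union> V"
    and indep: "\<forall>u\<in>U. \<forall>v\<in>U. (u, v) \<notin> parcs (AG R M)" "\<forall>u\<in>V. \<forall>v\<in>V. (u, v) \<notin> parcs (AG R M)"
    using assms unfolding bipartite_def independent_set_def by blast
  have "X \<in> U \<or> X \<in> V" "Y \<in> U \<or> Y \<in> V" "Z \<in> U \<or> Z \<in> V"
    using verts UV by (auto simp: AG_def)
  then show False using arcs indep by metis
qed

lemma star_graph_if_center:
  assumes tf: triangle_free and c: "C \<in> AG_verts R M"
    and adj: "\<And>N. N \<in> AG_verts R M \<Longrightarrow> N \<noteq> C \<Longrightarrow> orth C N"
  shows "star_graph (AG R M)"
proof -
  have vert: "submod N" "N \<noteq> {\<zero>\<^bsub>M\<^esub>}" if "N \<in> AG_verts R M" for N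
    using that by (auto simp: AG_verts_def)
  have adj': "orth N C" if "N \<in> AG_verts R M" "N \<noteq> C" for N
    using adj[OF that] orth_sym vert that(1) c by blast
  have leaves: "\<not> orth N K" if "N \<in> AG_verts R M" "K \<in> AG_verts R M" "N \<noteq> C" "K \<noteq> C" "N \<noteq> K" for N K
    using no_triangle[OF tf, of C N K] adj vert that c by metis
  have "(N, K) \<in> parcs (AG R M) \<longleftrightarrow>
      (N, K) \<in> {C} \<times> (AG_verts R M - {C}) \<union> (AG_verts R M - {C}) \<times> {C}" for N K
    using c adj[of K] adj'[of N] leaves[of N K]
    by (cases "N = C"; cases "K = C"; simp add: AG_def; blast)
  then have "parcs (AG R M) = {C} \<times> (AG_verts R M - {C}) \<union> (AG_verts R M - {C}) \<times> {C}"
    by - (rule subset_antisym; rule subrelI; simp)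
  then have "complete_bipartite_with_parts {C} (AG_verts R M - {C}) (AG R M)"
    unfolding complete_bipartite_with_parts_def using c by (auto simp: AG_def)
  then show ?thesis unfolding star_graph_def by blast
qed

end

section \<open>Complementary idempotents\<close>

lemma (in cring) idempotent_complement:
  assumes e: "e \<in> carrier R" "e \<otimes> e = e"
  shows "\<one> \<ominus> e \<in> carrier R" "(\<one> \<ominus> e) \<otimes> (\<one> \<ominus> e) = \<one> \<ominus> e"
    "e \<otimes> (\<one> \<ominus> e) = \<zero>" "e \<oplus> (\<one> \<ominus> e) = \<one>"
proof -
  show "\<one> \<ominus> e \<in> carrier R" using e by simp
  show 0: "e \<otimes> (\<one> \<ominus> e) = \<zero>"
    using e by (simp add: a_minus_def r_distr r_minus r_neg)
  show "(\<one> \<ominus> e) \<otimes> (\<one> \<ominus> e) = \<one> \<ominus> e"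
  proof -
    \<comment> \<open>Expanding only the left factor leaves \<open>e (1 - e)\<close>, which is known to vanish.\<close>
    have "(\<one> \<ominus> e) \<otimes> (\<one> \<ominus> e) = (\<one> \<ominus> e) \<ominus> e \<otimes> (\<one> \<ominus> e)"
      using e by (simp add: a_minus_def l_distr l_minus)
    then show ?thesis using 0 e by (simp add: a_minus_def)
  qed
  show "e \<oplus> (\<one> \<ominus> e) = \<one>"
    using e by (simp add: a_minus_def a_lcomm[of e] r_neg)
qed

context module
begin

text \<open>
  A splitting \<open>1 = e + f\<close> into orthogonal idempotents for which both summands of
  \<open>M = eM + fM\<close> are nonzero.
\<close>

definition complementary where
  "complementary e f \<longleftrightarrow> e \<in> carrier R \<and> f \<in> carrier R \<and> e \<otimes> e = e \<and> f \<otimes> f = f \<and>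
     e \<otimes> f = \<zero> \<and> e \<oplus> f = \<one> \<and> e \<notin> Ann \<and> f \<notin> Ann"

lemma complementary_sym: "complementary e f \<Longrightarrow> complementary f e"
  unfolding complementary_def using R.m_comm R.a_comm by auto

lemma complementary_smult:
  assumes ef: "complementary e f" and x: "x \<in> carrier M"
  shows "e \<odot>\<^bsub>M\<^esub> (e \<odot>\<^bsub>M\<^esub> x) = e \<odot>\<^bsub>M\<^esub> x" "e \<odot>\<^bsub>M\<^esub> (f \<odot>\<^bsub>M\<^esub> x) = \<zero>\<^bsub>M\<^esub>"
    "f \<odot>\<^bsub>M\<^esub> (e \<odot>\<^bsub>M\<^esub> x) = \<zero>\<^bsub>M\<^esub>" "e \<odot>\<^bsub>M\<^esub> x \<oplus>\<^bsub>M\<^esub> f \<odot>\<^bsub>M\<^esub> x = x"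
proof -
  have *: "e \<in> carrier R" "f \<in> carrier R" "e \<otimes> e = e" "e \<otimes> f = \<zero>" "f \<otimes> e = \<zero>" "e \<oplus> f = \<one>"
    using ef by (auto simp: complementary_def m_comm)
  show "e \<odot>\<^bsub>M\<^esub> (e \<odot>\<^bsub>M\<^esub> x) = e \<odot>\<^bsub>M\<^esub> x" "e \<odot>\<^bsub>M\<^esub> (f \<odot>\<^bsub>M\<^esub> x) = \<zero>\<^bsub>M\<^esub>"
    "f \<odot>\<^bsub>M\<^esub> (e \<odot>\<^bsub>M\<^esub> x) = \<zero>\<^bsub>M\<^esub>" "e \<odot>\<^bsub>M\<^esub> x \<oplus>\<^bsub>M\<^esub> f \<odot>\<^bsub>M\<^esub> x = x"
    using * x by (simp_all flip: smult_assoc1 smult_l_distr)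
qed

lemma smult_range_complementary:
  assumes ef: "complementary e f"
  shows "x \<in> smult_range e \<Longrightarrow> e \<odot>\<^bsub>M\<^esub> x = x" "x \<in> smult_range e \<Longrightarrow> f \<odot>\<^bsub>M\<^esub> x = \<zero>\<^bsub>M\<^esub>"
  unfolding smult_range_def by (auto simp: complementary_smult[OF ef])

lemma complementary_disjoint:
  assumes ef: "complementary e f" and "N \<subseteq> smult_range e" "K \<subseteq> smult_range f"
  shows "N \<inter> K \<subseteq> {\<zero>\<^bsub>M\<^esub>}"
proof
  fix x assume "x \<in> N \<inter> K"
  then have "x \<in> smult_range e" "x \<in> smult_range f" using assms(2,3) by auto
  then have "e \<odot>\<^bsub>M\<^esub> x = x" "e \<odot>\<^bsub>M\<^esub> x = \<zero>\<^bsub>M\<^esub>"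
    using smult_range_complementary(1)[OF ef]
      smult_range_complementary(2)[OF complementary_sym[OF ef]] by blast+
  then show "x \<in> {\<zero>\<^bsub>M\<^esub>}" by simp
qed

lemma complementary_orth:
  "\<lbrakk>complementary e f; submod N; submod K; N \<subseteq> smult_range e; K \<subseteq> smult_range f\<rbrakk> \<Longrightarrow> orth N K"
  by (rule orth_if_disjoint[OF _ _ complementary_disjoint])

lemma complementary_block_facts:
  assumes ef: "complementary e f"
  shows "e \<in> carrier R" "submod (smult_range e)" "smult_range e \<noteq> {\<zero>\<^bsub>M\<^esub>}"
    "smult_range e \<noteq> carrier M" "smult_range e \<noteq> smult_range f"
proof -
  show e: "e \<in> carrier R" and ne: "smult_range e \<noteq> {\<zero>\<^bsub>M\<^esub>}" and "submod (smult_range e)"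
    using ef submod_smult_range smult_range_zero_iff by (auto simp: complementary_def)
  have sub: "submod (smult_range e)" "submod (smult_range f)"
    using ef submod_smult_range by (auto simp: complementary_def)
  show "smult_range e \<noteq> smult_range f"
    using complementary_disjoint[OF ef order_refl order_refl] ne submod_zero[OF sub(1)] by auto
  show "smult_range e \<noteq> carrier M"
  proof
    assume "smult_range e = carrier M"
    then have "f \<odot>\<^bsub>M\<^esub> x = \<zero>\<^bsub>M\<^esub>" if "x \<in> carrier M" for x
      using smult_range_complementary(2)[OF ef] that by simp
    then show False using ef by (auto simp: complementary_def Ann_def)
  qed
qed

lemma complementary_carrier_components:
  assumes ef: "complementary e f"
  shows "{\<zero>\<^bsub>M\<^esub>} \<inter> smult_range e = {\<zero>\<^bsub>M\<^esub>}" "carrier M \<inter> smult_range e = smult_range e"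
    "smult_range e \<inter> smult_range f = {\<zero>\<^bsub>M\<^esub>}"
proof -
  have sub: "submod (smult_range e)" "submod (smult_range f)"
    using complementary_block_facts(2) ef complementary_sym by blast+
  show "{\<zero>\<^bsub>M\<^esub>} \<inter> smult_range e = {\<zero>\<^bsub>M\<^esub>}" "carrier M \<inter> smult_range e = smult_range e"
    using submod_zero submod_subset sub(1) by blast+
  show "smult_range e \<inter> smult_range f = {\<zero>\<^bsub>M\<^esub>}"
    using complementary_disjoint[OF ef order_refl order_refl] submod_zero sub by blast
qed

text \<open>
  A submodule is stable under \<open>e\<close> and \<open>f\<close>, so it is the sum of its intersections with the two blocks.
  Thus the submodules of \<open>M\<close> can be enumerated once those of \<open>eM\<close> and \<open>fM\<close> are known.
\<close>

lemma submod_mem_iff_components: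
  assumes ef: "complementary e f" and N: "submod N"
  shows "x \<in> N \<longleftrightarrow> x \<in> carrier M \<and> e \<odot>\<^bsub>M\<^esub> x \<in> N \<inter> smult_range e \<and> f \<odot>\<^bsub>M\<^esub> x \<in> N \<inter> smult_range f"
proof
  assume "x \<in> N"
  then show "x \<in> carrier M \<and> e \<odot>\<^bsub>M\<^esub> x \<in> N \<inter> smult_range e \<and> f \<odot>\<^bsub>M\<^esub> x \<in> N \<inter> smult_range f"
    using ef submod_subset[OF N] submoduleE(4)[OF N] by (auto simp: complementary_def smult_range_def)
next
  assume "x \<in> carrier M \<and> e \<odot>\<^bsub>M\<^esub> x \<in> N \<inter> smult_range e \<and> f \<odot>\<^bsub>M\<^esub> x \<in> N \<inter> smult_range f"
  then show "x \<in> N"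
    using complementary_smult(4)[OF ef, of x] submoduleE(5)[OF N, of "e \<odot>\<^bsub>M\<^esub> x" "f \<odot>\<^bsub>M\<^esub> x"] by auto
qed

lemma submod_eq_if_components_eq:
  assumes ef: "complementary e f" and "submod N" "submod K"
    and "N \<inter> smult_range e = K \<inter> smult_range e" "N \<inter> smult_range f = K \<inter> smult_range f"
  shows "N = K"
  by (rule Set.set_eqI)
    (simp only: submod_mem_iff_components[OF ef assms(2)] submod_mem_iff_components[OF ef assms(3)]
      assms(4,5))

definition simple_submod where
  "simple_submod N \<longleftrightarrow> submod N \<and> N \<noteq> {\<zero>\<^bsub>M\<^esub>} \<and>
     (\<forall>L. submod L \<and> L \<subseteq> N \<longrightarrow> L = {\<zero>\<^bsub>M\<^esub>} \<or> L = N)"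

lemma submods_of_two_simple_blocks:
  assumes ef: "complementary e f"
    and simple: "simple_submod (smult_range e)" "simple_submod (smult_range f)" and N: "submod N"
  shows "N = {\<zero>\<^bsub>M\<^esub>} \<or> N = smult_range e \<or> N = smult_range f \<or> N = carrier M"
proof -
  note fe = complementary_sym[OF ef]
  note sub = complementary_block_facts(2)[OF ef] complementary_block_facts(2)[OF fe]
  note ints = complementary_carrier_components[OF ef] complementary_carrier_components[OF fe]
  have "N \<inter> smult_range e = {\<zero>\<^bsub>M\<^esub>} \<or> N \<inter> smult_range e = smult_range e"
    "N \<inter> smult_range f = {\<zero>\<^bsub>M\<^esub>} \<or> N \<inter> smult_range f = smult_range f"
    using simple submod_Int[OF N sub(1)] submod_Int[OF N sub(2)] unfolding simple_submod_def by blast+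
  then show ?thesis
    using submod_eq_if_components_eq[OF ef N] ints submod_of_zero carrier_is_submodule sub
    by (metis inf_idem)
qed

end

section \<open>Unsplittable idempotents and their socles\<close>

context module
begin

text \<open>
  Idempotents are compared by their action on \<open>M\<close> only: \<open>g\<close> does not kill \<open>M\<close>, and an idempotent
  multiple of \<open>g\<close> acts as zero or as \<open>g\<close>.
\<close>

definition primitive where
  "primitive g \<longleftrightarrow> g \<in> carrier R \<and> g \<otimes> g = g \<and> g \<notin> Ann \<and>
     (\<forall>e\<in>carrier R. e \<otimes> e = e \<and> e \<otimes> g = e \<longrightarrow>
        e \<in> Ann \<or> (\<forall>x\<in>carrier M. e \<odot>\<^bsub>M\<^esub> x = g \<odot>\<^bsub>M\<^esub> x))"

lemma ex_complementary_if_one_not_primitive: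
  assumes "\<one> \<notin> Ann" "\<not> primitive \<one>"
  shows "\<exists>e f. complementary e f"
proof -
  obtain e x where e: "e \<in> carrier R" "e \<otimes> e = e" "e \<notin> Ann"
    and x: "x \<in> carrier M" "e \<odot>\<^bsub>M\<^esub> x \<noteq> x"
    using assms unfolding primitive_def by auto
  note f = idempotent_complement[OF e(1,2)]
  have "\<one> \<ominus> e \<notin> Ann"
  proof
    assume "\<one> \<ominus> e \<in> Ann"
    have "x = (e \<oplus> (\<one> \<ominus> e)) \<odot>\<^bsub>M\<^esub> x" using f(4) x(1) by simp
    also have "\<dots> = e \<odot>\<^bsub>M\<^esub> x"
      using e(1) f(1) x(1) Ann_D[OF \<open>\<one> \<ominus> e \<in> Ann\<close> x(1)] by (simp add: smult_l_distr)
    finally show False using x(2) by simp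
  qed
  then have "complementary e (\<one> \<ominus> e)" using e f by (simp add: complementary_def)
  then show ?thesis by blast
qed

text \<open>
  If \<open>e\<close> split as \<open>d + e(1 - d)\<close>, the submodules \<open>dM\<close>, \<open>e(1 - d)M\<close> and \<open>fM\<close> would form a triangle.
\<close>

lemma complementary_primitive:
  assumes tf: triangle_free and ef: "complementary e f" shows "primitive e"
proof (rule ccontr)
  assume "\<not> primitive e"
  have e: "e \<in> carrier R" "e \<otimes> e = e" "e \<notin> Ann"
    and f: "f \<in> carrier R" "f \<otimes> f = f" "f \<notin> Ann" and ef0: "e \<otimes> f = \<zero>"
    using ef by (auto simp: complementary_def)
  obtain d x where d: "d \<in> carrier R" "d \<otimes> d = d" "d \<otimes> e = d" "d \<notin> Ann"
    and x: "x \<in> carrier M" "d \<odot>\<^bsub>M\<^esub> x \<noteq> e \<odot>\<^bsub>M\<^esub> x"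
    using \<open>\<not> primitive e\<close> e unfolding primitive_def by blast
  note c = idempotent_complement[OF d(1,2)]
  let ?d' = "e \<otimes> (\<one> \<ominus> d)"
  have d'R: "?d' \<in> carrier R" using e c by simp
  have "?d' \<otimes> ?d' = (e \<otimes> e) \<otimes> ((\<one> \<ominus> d) \<otimes> (\<one> \<ominus> d))"
    using e(1) c(1) by (simp only: m_ac m_closed)
  then have d'_idem: "?d' \<otimes> ?d' = ?d'" by (simp only: e(2) c(2))
  have "d \<otimes> ?d' = e \<otimes> (d \<otimes> (\<one> \<ominus> d))"
    using e(1) c(1) d(1) by (simp only: m_ac m_closed)
  then have dd': "d \<otimes> ?d' \<in> Ann" using e(1) by (simp add: c(3) Ann_I)
  have "d \<otimes> f = d \<otimes> (e \<otimes> f)" using d e(1) f(1) by (metis m_assoc)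
  then have df: "d \<otimes> f \<in> Ann" using d(1) by (simp add: ef0 Ann_I)
  have "?d' \<otimes> f = (\<one> \<ominus> d) \<otimes> (e \<otimes> f)"
    using e(1) c(1) f(1) by (simp only: m_ac m_closed)
  then have d'f: "?d' \<otimes> f \<in> Ann" using c(1) by (simp add: ef0 Ann_I)
  have d'_notin: "?d' \<notin> Ann"
  proof
    assume d': "?d' \<in> Ann"
    have "e = e \<otimes> (d \<oplus> (\<one> \<ominus> d))" using e(1) by (simp only: c(4) r_one)
    also have "\<dots> = d \<oplus> ?d'" using e(1) d(1,3) c(1) by (simp only: r_distr m_comm[of e d])
    finally have "e \<odot>\<^bsub>M\<^esub> x = (d \<oplus> ?d') \<odot>\<^bsub>M\<^esub> x" by (rule arg_cong)
    also have "\<dots> = d \<odot>\<^bsub>M\<^esub> x"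
      using d(1) d'R x(1) Ann_D[OF d' x(1)] by (simp only: smult_l_distr) (simp add: d(1) x(1))
    finally show False using x(2) by simp
  qed
  show False
    by (rule no_triangle[OF tf, of "smult_range d" "smult_range ?d'" "smult_range f"])
      (simp_all only: submod_smult_range smult_range_zero_iff orth_smult_ranges
        smult_range_distinct d d'R f d'_idem d'_notin dd' df d'f not_False_eq_True)
qed

text \<open>
  When each ring element is nilpotent or invertible on \<open>gM\<close>, the last condition says that all
  elements that are not invertible on \<open>gM\<close> kill \<open>bM\<close>; so \<open>bM\<close> lies in the socle of \<open>gM\<close>.
\<close>

definition socle_generator where
  "socle_generator g b \<longleftrightarrow> b \<in> carrier R \<and> b \<notin> Ann \<and> b \<otimes> g = b \<and>
     (\<forall>L. submod L \<and> \<not> smult_range g \<subseteq> L \<longrightarrow> (\<forall>a\<in>res L. a \<otimes> b \<in> Ann))"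

lemma socle_generatorD:
  assumes "socle_generator g b"
  shows "b \<in> carrier R" "b \<notin> Ann" "b \<otimes> g = b"
    "\<And>L a. submod L \<Longrightarrow> \<not> smult_range g \<subseteq> L \<Longrightarrow> a \<in> res L \<Longrightarrow> a \<otimes> b \<in> Ann"
  using assms unfolding socle_generator_def by blast+

lemma socle_generator_range_subset:
  assumes "socle_generator g b" "g \<in> carrier R"
  shows "smult_range b \<subseteq> smult_range g"
proof
  fix y assume "y \<in> smult_range b"
  then obtain x where x: "x \<in> carrier M" "y = b \<odot>\<^bsub>M\<^esub> x" by (auto simp: smult_range_def)
  have "y = (g \<otimes> b) \<odot>\<^bsub>M\<^esub> x"
    using socle_generatorD(1,3)[OF assms(1)] assms(2) x by (simp add: m_comm)
  also have "\<dots> = g \<odot>\<^bsub>M\<^esub> (b \<odot>\<^bsub>M\<^esub> x)"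
    using socle_generatorD(1)[OF assms(1)] assms(2) x by (simp add: smult_assoc1)
  finally show "y \<in> smult_range g"
    using socle_generatorD(1)[OF assms(1)] x(1) by (auto simp: smult_range_def)
qed

lemma socle_generator_square:
  assumes "socle_generator g b" "g \<in> carrier R" "smult_range b \<noteq> smult_range g"
  shows "b \<otimes> b \<in> Ann"
  using socle_generatorD[OF assms(1)] socle_generator_range_subset[OF assms(1,2)] assms(3)
    submod_smult_range in_res_smult_range by (metis subset_antisym)

lemma residual_kills_block_if_socle_full:
  assumes "socle_generator g b" "g \<in> carrier R" "smult_range b = smult_range g"
    and "submod L" "\<not> smult_range g \<subseteq> L" "a \<in> res L"
  shows "a \<otimes> g \<in> Ann"
proof (rule Ann_I)
  have a: "a \<in> carrier R" using assms(6) by (rule res_carrier)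
  then show "a \<otimes> g \<in> carrier R" using assms(2) by simp
  fix x assume x: "x \<in> carrier M"
  then obtain y where y: "y \<in> carrier M" "g \<odot>\<^bsub>M\<^esub> x = b \<odot>\<^bsub>M\<^esub> y"
    using assms(3) unfolding smult_range_def by blast
  have "(a \<otimes> g) \<odot>\<^bsub>M\<^esub> x = (a \<otimes> b) \<odot>\<^bsub>M\<^esub> y"
    using a assms(2) x y socle_generatorD(1)[OF assms(1)] by (simp add: smult_assoc1)
  then show "(a \<otimes> g) \<odot>\<^bsub>M\<^esub> x = \<zero>\<^bsub>M\<^esub>"
    using Ann_D[OF socle_generatorD(4)[OF assms(1,4-6)] y(1)] by simp
qed

lemma orth_socle:
  assumes "socle_generator g b" "submod L" "\<not> smult_range g \<subseteq> L"
  shows "orth (smult_range b) L"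
  using assms by (intro orth_smult_range socle_generatorD) auto

end

text \<open>
  The chain condition in the form in which it is used: a nonempty set of ring elements contains
  an element \<open>b\<close> whose principal ideal is generated by each multiple of \<open>b\<close> that lies in the set.
  Otherwise, passing repeatedly to a worse multiple gives a strictly descending chain of
  principal ideals.
\<close>

lemma (in artinian_cring) ex_minimal_multiple:
  assumes "Q \<subseteq> carrier R" "Q \<noteq> {}"
  shows "\<exists>b\<in>Q. \<forall>r\<in>carrier R. r \<otimes> b \<in> Q \<longrightarrow> (\<exists>s\<in>carrier R. b = s \<otimes> (r \<otimes> b))"
proof (rule ccontr)
  assume "\<not> ?thesis"
  then have "\<forall>b\<in>Q. \<exists>c\<in>Q. (\<exists>r\<in>carrier R. c = r \<otimes> b) \<and> \<not> (\<exists>s\<in>carrier R. b = s \<otimes> c)"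
    by blast
  then obtain next_el where step: "\<And>b. b \<in> Q \<Longrightarrow> next_el b \<in> Q \<and>
      (\<exists>r\<in>carrier R. next_el b = r \<otimes> b) \<and> \<not> (\<exists>s\<in>carrier R. b = s \<otimes> next_el b)"
    by metis
  obtain b0 where b0: "b0 \<in> Q" using assms(2) by blast
  define chain where "chain n = (next_el ^^ n) b0" for n
  have chain: "chain n \<in> Q" for n
    by (induction n) (simp_all add: chain_def b0 step)
  have carr: "chain n \<in> carrier R" for n using chain assms(1) by blast
  have "\<exists>n. \<forall>k\<ge>n. PIdl (chain k) = PIdl (chain n)"
  proof (rule descending_chain_condition)
    show "ideal (PIdl (chain i)) R" for i by (rule cgenideal_ideal[OF carr])
    show "PIdl (chain (Suc i)) \<subseteq> PIdl (chain i)" for i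
    proof (rule cgenideal_minimal[OF cgenideal_ideal[OF carr]])
      show "chain (Suc i) \<in> PIdl (chain i)"
        using step[OF chain[of i]] by (auto simp: cgenideal_def chain_def)
    qed
  qed
  then obtain n where "PIdl (chain (Suc n)) = PIdl (chain n)" by (metis le_add2 plus_1_eq_Suc)
  then have "chain n \<in> PIdl (chain (Suc n))" using cgenideal_self[OF carr] by simp
  then show False using step[OF chain[of n]] by (auto simp: cgenideal_def chain_def)
qed

text \<open>
  Minimality among the powers of \<open>a\<close>, applied to the square of a minimal one. The exponent is
  positive, because the exponent zero would carry no information about \<open>a\<close>.
\<close>

lemma (in artinian_cring) ex_power_regular:
  assumes a: "a \<in> carrier R"
  shows "\<exists>n. \<exists>r\<in>carrier R. a [^] Suc n = r \<otimes> (a [^] Suc n \<otimes> a [^] Suc n)"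
proof -
  let ?Q = "range (\<lambda>n::nat. a [^] Suc n)"
  obtain b where b: "b \<in> ?Q"
    "\<forall>r\<in>carrier R. r \<otimes> b \<in> ?Q \<longrightarrow> (\<exists>s\<in>carrier R. b = s \<otimes> (r \<otimes> b))"
    using ex_minimal_multiple[of ?Q] a by blast
  from b(1) obtain n where n: "b = a [^] Suc n" by blast
  \<comment> \<open>The square of a minimal power is again a power with positive exponent.\<close>
  have "b \<otimes> b = a [^] (Suc n + Suc n)" unfolding n using a by (rule nat_pow_mult)
  then have "b \<otimes> b = a [^] Suc (n + Suc n)" by simp
  then have "b \<otimes> b \<in> ?Q" by (rule image_eqI) simp
  moreover have "b \<in> carrier R" using a n by simp
  ultimately show ?thesis using b(2) n by blast
qed

locale artinian_module = module R M + artinian_cring R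
  for R :: "('a, 'b) ring_scheme" (structure) and M :: "('a, 'c, 'd) module_scheme" (structure)

context artinian_module
begin

text \<open>
  With \<open>p = a\<^sup>n\<close> and \<open>p = r p\<^sup>2\<close>, the element \<open>r p g\<close> is an idempotent multiple of \<open>g\<close>. If it acts as
  \<open>g\<close>, then \<open>r a\<^sup>n\<close> is the identity on \<open>gM\<close>, and \<open>a\<close> is invertible there. If it acts as zero, so does \<open>p g\<close>,
  because \<open>p g = p (r p g)\<close>.
\<close>

lemma primitive_nilpotent_or_invertible:
  assumes g: "primitive g" and a: "a \<in> carrier R"
  shows "(\<exists>n::nat. a [^] n \<otimes> g \<in> Ann) \<or>
    (\<exists>c\<in>carrier R. \<forall>x\<in>carrier M. c \<odot>\<^bsub>M\<^esub> (a \<odot>\<^bsub>M\<^esub> (g \<odot>\<^bsub>M\<^esub> x)) = g \<odot>\<^bsub>M\<^esub> x)"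
proof -
  have gR: "g \<in> carrier R" "g \<otimes> g = g" using g by (auto simp: primitive_def)
  obtain n r where r: "r \<in> carrier R" "a [^] Suc n = r \<otimes> (a [^] Suc n \<otimes> a [^] Suc n)"
    using ex_power_regular[OF a] by blast
  define p where "p = a [^] Suc n"
  have p: "p \<in> carrier R" "p = r \<otimes> (p \<otimes> p)" using a r by (simp_all only: p_def nat_pow_closed)
  define e where "e = r \<otimes> p \<otimes> g"
  have eR: "e \<in> carrier R" using p(1) r(1) gR by (simp add: e_def)
  have "e \<otimes> e = r \<otimes> (r \<otimes> (p \<otimes> p)) \<otimes> (g \<otimes> g)"
    using p(1) r(1) gR(1) by (simp add: e_def m_ac)
  then have ee: "e \<otimes> e = e" using p(2) gR(2) by (simp add: e_def)
  have eg: "e \<otimes> g = e" using p(1) r(1) gR by (simp add: e_def m_assoc)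
  consider "e \<in> Ann" | "\<forall>x\<in>carrier M. e \<odot>\<^bsub>M\<^esub> x = g \<odot>\<^bsub>M\<^esub> x"
    using g ee eg eR unfolding primitive_def by blast
  then show ?thesis
  proof cases
    case 1
    have "p \<otimes> e = r \<otimes> (p \<otimes> p) \<otimes> g" using p(1) r(1) gR(1) by (simp add: e_def m_ac)
    then have "p \<otimes> g \<in> Ann" using p(2) Ann_mult_l[OF 1 p(1)] by simp
    then show ?thesis unfolding p_def by blast
  next
    case 2
    have "(r \<otimes> a [^] n) \<odot>\<^bsub>M\<^esub> (a \<odot>\<^bsub>M\<^esub> (g \<odot>\<^bsub>M\<^esub> x)) = e \<odot>\<^bsub>M\<^esub> x" if "x \<in> carrier M" for x
      using a r(1) gR(1) that by (simp add: e_def p_def smult_assoc1)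
    then show ?thesis using 2 a r(1) by (metis m_closed nat_pow_closed)
  qed
qed

text \<open>
  Take \<open>b\<close> minimal among the multiples of \<open>g\<close> that do not kill \<open>M\<close>. If \<open>a \<in> (L : M)\<close> were invertible
  on \<open>gM\<close>, then \<open>gM\<close> would be contained in \<open>L\<close>; hence \<open>a\<close> is nilpotent on \<open>gM\<close>. If \<open>a b\<close> did not kill \<open>M\<close>, minimality
  would give \<open>b = s a b\<close>, hence \<open>b \<in> a\<^sup>n b R\<close> for all \<open>n\<close>, and \<open>b\<close> would kill \<open>M\<close> after all.
\<close>

lemma ex_socle_generator:
  assumes g: "primitive g" shows "\<exists>b. socle_generator g b"
proof -
  have gR: "g \<in> carrier R" "g \<otimes> g = g" "g \<notin> Ann" using g by (auto simp: primitive_def)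
  let ?Q = "{b \<in> carrier R. b \<otimes> g = b \<and> b \<notin> Ann}"
  have "g \<in> ?Q" using gR by simp
  then obtain b where b: "b \<in> carrier R" "b \<otimes> g = b" "b \<notin> Ann"
    and min: "\<And>r. r \<in> carrier R \<Longrightarrow> r \<otimes> b \<in> ?Q \<Longrightarrow> \<exists>s\<in>carrier R. b = s \<otimes> (r \<otimes> b)"
    using ex_minimal_multiple[of ?Q] by blast
  have "a \<otimes> b \<in> Ann" if L: "submod L" "\<not> smult_range g \<subseteq> L" and aL: "a \<in> res L" for L a
  proof (rule ccontr)
    assume not: "a \<otimes> b \<notin> Ann"
    have a: "a \<in> carrier R" using aL by (rule res_carrier)
    have "a \<otimes> b \<in> ?Q" using not a b gR by (simp add: m_assoc)
    then obtain s where s: "s \<in> carrier R" "b = s \<otimes> (a \<otimes> b)" using min a by blast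
    have "\<not> (\<exists>c\<in>carrier R. \<forall>x\<in>carrier M. c \<odot>\<^bsub>M\<^esub> (a \<odot>\<^bsub>M\<^esub> (g \<odot>\<^bsub>M\<^esub> x)) = g \<odot>\<^bsub>M\<^esub> x)"
    proof
      assume "\<exists>c\<in>carrier R. \<forall>x\<in>carrier M. c \<odot>\<^bsub>M\<^esub> (a \<odot>\<^bsub>M\<^esub> (g \<odot>\<^bsub>M\<^esub> x)) = g \<odot>\<^bsub>M\<^esub> x"
      then obtain c where c: "c \<in> carrier R"
        "\<And>x. x \<in> carrier M \<Longrightarrow> c \<odot>\<^bsub>M\<^esub> (a \<odot>\<^bsub>M\<^esub> (g \<odot>\<^bsub>M\<^esub> x)) = g \<odot>\<^bsub>M\<^esub> x" by blast
      have "g \<odot>\<^bsub>M\<^esub> x \<in> L" if "x \<in> carrier M" for x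
        using c(2)[OF that] submoduleE(4)[OF L(1) c(1) res_D[OF aL smult_closed[OF gR(1) that]]]
        by simp
      then show False using L(2) unfolding smult_range_def by blast
    qed
    then obtain n :: nat where n: "a [^] n \<otimes> g \<in> Ann"
      using primitive_nilpotent_or_invertible[OF g a] by blast
    have "\<exists>t\<in>carrier R. b = t \<otimes> (a [^] k \<otimes> b)" for k :: nat
    proof (induction k)
      case 0
      show ?case using b(1) by (intro bexI[of _ \<one>]) simp_all
    next
      case (Suc k)
      then obtain t where t: "t \<in> carrier R" "b = t \<otimes> (a [^] k \<otimes> b)" by blast
      have "b = t \<otimes> (a [^] k \<otimes> (s \<otimes> (a \<otimes> b)))" using s(2) t(2) by simp
      also have "\<dots> = (t \<otimes> s) \<otimes> (a [^] Suc k \<otimes> b)"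
        using a b(1) s(1) t(1) by (simp add: m_ac)
      finally show ?case using s(1) t(1) by blast
    qed
    then obtain t where t: "t \<in> carrier R" "b = t \<otimes> (a [^] n \<otimes> b)" by blast
    then have "b = t \<otimes> (a [^] n \<otimes> (b \<otimes> g))" using b(2) by simp
    also have "\<dots> = (t \<otimes> b) \<otimes> (a [^] n \<otimes> g)" using t(1) a b(1) gR(1) by (simp add: m_ac)
    also have "\<dots> \<in> Ann" using n t(1) b(1) by (simp add: Ann_mult_l)
    finally show False using b(3) by blast
  qed
  then show ?thesis using b unfolding socle_generator_def by blast
qed

end

section \<open>Modules that do not split\<close>

context module
begin

text \<open>
  If \<open>bM = M\<close>, the residual of each proper submodule kills \<open>M\<close>, so that any two distinct submodules,
  one of them proper, have product zero. Hence two distinct non-trivial submodules form a triangle with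
  \<open>M\<close>. Such a second submodule is \<open>Ry\<close> with \<open>y\<close> outside \<open>N\<close>: if \<open>Ry\<close> were all of \<open>M\<close>, a nonzero
  \<open>z \<in> N\<close> would be \<open>r y\<close> with \<open>rM = M\<close>, and \<open>y\<close> would be a multiple of \<open>z\<close>.
\<close>

lemma socle_generator_one_proper:
  assumes tf: triangle_free and b: "socle_generator \<one> b" and N: "nontrivial_submodule N R M"
  shows "smult_range b \<noteq> carrier M"
proof
  assume full: "smult_range b = carrier M"
  have N': "submod N" "N \<noteq> {\<zero>\<^bsub>M\<^esub>}" "N \<noteq> carrier M"
    using N by (auto simp: nontrivial_submodule_def)
  have res_Ann: "res L \<subseteq> Ann" if "submod L" "L \<noteq> carrier M" for L
  proof
    fix a assume a: "a \<in> res L"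
    have "\<not> smult_range \<one> \<subseteq> L" using that submoduleE(1) by (auto simp: smult_range_one)
    then have "a \<otimes> \<one> \<in> Ann"
      using residual_kills_block_if_socle_full[OF b] full that(1) a by (simp add: smult_range_one)
    then show "a \<in> Ann" using res_carrier[OF a] by simp
  qed
  obtain y where y: "y \<in> carrier M" "y \<notin> N" using N' submoduleE(1) by blast
  obtain z where z: "z \<in> N" "z \<noteq> \<zero>\<^bsub>M\<^esub>" using N' submod_zero by blast
  let ?Y = "(\<lambda>r. r \<odot>\<^bsub>M\<^esub> y) ` carrier R"
  have Y: "submod ?Y"
    unfolding submodule_iff
  proof (intro conjI ballI)
    show "\<zero>\<^bsub>M\<^esub> \<in> ?Y" using y(1) by (intro image_eqI[of _ _ \<zero>]) auto
  qed (use y(1) in \<open>auto simp flip: smult_l_distr smult_assoc1\<close>)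
  have yY: "y \<in> ?Y" using y(1) by (intro image_eqI[of _ _ \<one>]) auto
  have "?Y \<noteq> carrier M"
  proof
    assume "?Y = carrier M"
    then obtain r where r: "r \<in> carrier R" "z = r \<odot>\<^bsub>M\<^esub> y"
      using z(1) submod_subset[OF N'(1)] by blast
    have "smult_range r = carrier M"
    proof (rule ccontr)
      assume "smult_range r \<noteq> carrier M"
      then have "r \<in> Ann"
        using res_Ann submod_smult_range in_res_smult_range r(1) by blast
      then show False using Ann_D y(1) r(2) z(2) by blast
    qed
    then obtain x where x: "x \<in> carrier M" "y = r \<odot>\<^bsub>M\<^esub> x" using y(1) by (auto simp: smult_range_def)
    then obtain s where s: "s \<in> carrier R" "x = s \<odot>\<^bsub>M\<^esub> y" using \<open>?Y = carrier M\<close> by blast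
    have "y = s \<odot>\<^bsub>M\<^esub> z" using x(2) s r y(1) by (simp add: smult_commute)
    then show False using submoduleE(4)[OF N'(1) s(1) z(1)] y(2) by simp
  qed
  moreover have "?Y \<noteq> {\<zero>\<^bsub>M\<^esub>}" using yY y(2) submod_zero[OF N'(1)] by (metis singletonD)
  moreover have "?Y \<noteq> N" using yY y(2) by blast
  moreover have "carrier M \<noteq> {\<zero>\<^bsub>M\<^esub>}" using N' submoduleE(1) submod_zero by blast
  ultimately show False
    using no_triangle[OF tf N'(1) Y carrier_is_submodule] N'
      orth_if_residual_in_Ann[OF _ _ res_Ann] Y carrier_is_submodule by metis
qed

end

context artinian_module
begin

text \<open>
  If \<open>M\<close> is a vertex, it has a non-trivial neighbour \<open>C\<close>; as \<open>(M : M)\<close> contains \<open>1\<close>, the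
  residual of \<open>C\<close> kills \<open>M\<close>, and \<open>C\<close> is the centre. Otherwise all vertices are proper, and the socle
  is the centre.
\<close>

lemma star_graph_if_one_primitive:
  assumes tf: triangle_free and one: "primitive \<one>" and ne: "AG_verts R M \<noteq> {}"
  shows "star_graph (AG R M)"
proof (cases "carrier M \<in> AG_verts R M")
  case True
  then obtain C where C: "submod C" "C \<noteq> {\<zero>\<^bsub>M\<^esub>}" "C \<noteq> carrier M" "orth (carrier M) C"
    using nontrivial_submodule_if_AG_vert by (auto simp: nontrivial_submodule_def)
  have "res C \<subseteq> Ann"
    using C(4) one_in_res_carrier res_carrier
    by (fastforce simp: orth_iff[OF carrier_is_submodule C(1)])
  then have orth: "orth C N" if "submod N" for N using orth_if_residual_in_Ann C(1) that by blast
  show ?thesis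
  proof (rule star_graph_if_center[OF tf])
    show "C \<in> AG_verts R M" using AG_vertI C orth by blast
    show "orth C N" if "N \<in> AG_verts R M" for N
      using that by (intro orth) (simp add: AG_verts_def)
  qed
next
  case False
  obtain b where b: "socle_generator \<one> b" using ex_socle_generator[OF one] by blast
  obtain N where N: "nontrivial_submodule N R M"
    using ne nontrivial_submodule_if_AG_vert by blast
  let ?B = "smult_range b"
  have B: "submod ?B" "?B \<noteq> {\<zero>\<^bsub>M\<^esub>}" "?B \<noteq> carrier M"
    using socle_generatorD[OF b] submod_smult_range smult_range_zero_iff
      socle_generator_one_proper[OF tf b N] by auto
  have orth: "orth ?B L" if "submod L" "L \<noteq> carrier M" for L
    using orth_socle[OF b that(1)] that submoduleE(1) by (auto simp: smult_range_one)
  show ?thesis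
  proof (rule star_graph_if_center[OF tf])
    show "?B \<in> AG_verts R M" using AG_vertI B orth by blast
    show "orth ?B L" if "L \<in> AG_verts R M" for L
      using that False by (intro orth) (auto simp: AG_verts_def)
  qed
qed

end

context module
begin

text \<open>
  What remains of \<open>M = F \<times> S\<close>, with a non-trivial submodule in \<open>S\<close>, when it is expressed by submodules
  of \<open>M\<close>.
\<close>

definition direct_sum_with_chain where
  "direct_sum_with_chain F S N \<longleftrightarrow> submod F \<and> submod S \<and> submod N \<and>
     F \<noteq> {\<zero>\<^bsub>M\<^esub>} \<and> N \<noteq> {\<zero>\<^bsub>M\<^esub>} \<and> N \<subset> S \<and> F \<inter> S = {\<zero>\<^bsub>M\<^esub>} \<and>
     (\<forall>x\<in>carrier M. \<exists>u\<in>F. \<exists>v\<in>S. x = u \<oplus>\<^bsub>M\<^esub> v)"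

end

context artinian_module
begin

text \<open>
  The socle \<open>bM\<close> is adjacent to all proper submodules, and \<open>F\<close> is adjacent to both \<open>S\<close> and \<open>N\<close>; without
  triangles this forces \<open>bM = F\<close>. But then \<open>b\<close> kills \<open>F = bM\<close> because \<open>b\<^sup>2\<close> kills \<open>M\<close>, and it kills \<open>S\<close>
  because \<open>bS \<subseteq> F \<inter> S\<close>.
\<close>

lemma one_primitive_no_direct_sum:
  assumes tf: triangle_free and one: "primitive \<one>"
  shows "\<not> direct_sum_with_chain F S N"
proof
  assume "direct_sum_with_chain F S N"
  then have sub: "submod F" "submod S" "submod N"
    and ne: "F \<noteq> {\<zero>\<^bsub>M\<^esub>}" "N \<noteq> {\<zero>\<^bsub>M\<^esub>}" "N \<subset> S"
    and disj: "F \<inter> S = {\<zero>\<^bsub>M\<^esub>}"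
    and span: "\<And>x. x \<in> carrier M \<Longrightarrow> \<exists>u\<in>F. \<exists>v\<in>S. x = u \<oplus>\<^bsub>M\<^esub> v"
    by (simp_all add: direct_sum_with_chain_def)
  obtain b where b: "socle_generator \<one> b" using ex_socle_generator[OF one] by blast
  let ?B = "smult_range b"
  have bR: "b \<in> carrier R" using socle_generatorD(1)[OF b] .
  have proper: "F \<noteq> carrier M" "S \<noteq> carrier M" "N \<noteq> carrier M" "S \<noteq> {\<zero>\<^bsub>M\<^esub>}" "F \<noteq> S" "F \<noteq> N"
    using ne disj sub submoduleE(1) submod_zero by blast+
  have N_nontriv: "nontrivial_submodule N R M"
    using sub(3) ne(2) proper(3) by (simp add: nontrivial_submodule_def)
  have B: "submod ?B" "?B \<noteq> {\<zero>\<^bsub>M\<^esub>}" "?B \<noteq> carrier M"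
    using socle_generatorD[OF b] submod_smult_range smult_range_zero_iff
      socle_generator_one_proper[OF tf b N_nontriv] by auto
  have orth: "orth ?B L" if "submod L" "L \<noteq> carrier M" for L
    using orth_socle[OF b that(1)] that submoduleE(1) by (auto simp: smult_range_one)
  have "F \<inter> S \<subseteq> {\<zero>\<^bsub>M\<^esub>}" "F \<inter> N \<subseteq> {\<zero>\<^bsub>M\<^esub>}" using disj ne(3) by blast+
  then have "orth F S" "orth F N" using sub by (simp_all only: orth_if_disjoint)
  then have "?B = F \<or> ?B = S" "?B = F \<or> ?B = N"
    using no_triangle[OF tf B(1) sub(1) sub(2)] no_triangle[OF tf B(1) sub(1) sub(3)]
      orth sub B ne proper by metis+
  then have BF: "?B = F" using ne(3) by blast
  have bb: "b \<otimes> b \<in> Ann"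
    using socle_generator_square[OF b] B(3) by (simp add: smult_range_one)
  have "b \<odot>\<^bsub>M\<^esub> x = \<zero>\<^bsub>M\<^esub>" if x: "x \<in> carrier M" for x
  proof -
    obtain u v where uv: "u \<in> F" "v \<in> S" "x = u \<oplus>\<^bsub>M\<^esub> v" using span[OF x] by blast
    have carr: "u \<in> carrier M" "v \<in> carrier M" using uv sub submod_subset by blast+
    obtain w where w: "w \<in> carrier M" "u = b \<odot>\<^bsub>M\<^esub> w" using uv(1) BF by (auto simp: smult_range_def)
    have "b \<odot>\<^bsub>M\<^esub> u = \<zero>\<^bsub>M\<^esub>" using Ann_D[OF bb w(1)] w bR by (simp add: smult_assoc1)
    moreover have "b \<odot>\<^bsub>M\<^esub> v \<in> F \<inter> S"
      using BF carr(2) submoduleE(4)[OF sub(2) bR uv(2)] by (auto simp: smult_range_def)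
    ultimately show ?thesis using disj carr bR uv(3) by (simp add: smult_r_distr)
  qed
  then show False using socle_generatorD(2)[OF b] Ann_I bR by blast
qed

end

section \<open>Modules that split into two blocks\<close>

context artinian_module
begin

text \<open>
  If the socle is all of \<open>eM\<close>, the residual of a submodule \<open>L\<close> that is non-trivial in \<open>eM\<close> kills
  \<open>eM\<close> and maps \<open>M\<close> into \<open>eM\<close>, so it kills \<open>M\<close>: indeed \<open>a x = e a x = a e x = 0\<close>. Then \<open>L\<close>, \<open>eM\<close> and \<open>fM\<close> form a triangle.
\<close>

lemma block_simple_or_proper_socle:
  assumes tf: triangle_free and ef: "complementary e f"
  shows "simple_submod (smult_range e) \<or>
    (\<exists>b. socle_generator e b \<and> smult_range b \<noteq> smult_range e)"
proof -
  obtain b where b: "socle_generator e b"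
    using ex_socle_generator[OF complementary_primitive[OF tf ef]] by blast
  note E = complementary_block_facts[OF ef]
  note F = complementary_block_facts[OF complementary_sym[OF ef]]
  have "simple_submod (smult_range e)" if full: "smult_range b = smult_range e"
  proof (rule ccontr)
    assume "\<not> simple_submod (smult_range e)"
    then obtain L where L: "submod L" "L \<subseteq> smult_range e" "L \<noteq> {\<zero>\<^bsub>M\<^esub>}" "L \<noteq> smult_range e"
      using E unfolding simple_submod_def by blast
    have "res L \<subseteq> Ann"
    proof
      fix a assume a: "a \<in> res L"
      then have aR: "a \<in> carrier R" by (rule res_carrier)
      have ae: "a \<otimes> e \<in> Ann"
        using residual_kills_block_if_socle_full[OF b E(1) full L(1) _ a] L by blast
      show "a \<in> Ann"
      proof (rule Ann_I[OF aR])
        fix x assume x: "x \<in> carrier M"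
        have ax: "a \<odot>\<^bsub>M\<^esub> x \<in> smult_range e" using res_D[OF a x] L(2) by blast
        have "a \<odot>\<^bsub>M\<^esub> x = e \<odot>\<^bsub>M\<^esub> (a \<odot>\<^bsub>M\<^esub> x)" using smult_range_complementary(1)[OF ef ax] by simp
        also have "\<dots> = (a \<otimes> e) \<odot>\<^bsub>M\<^esub> x" using aR E(1) x by (simp add: smult_assoc1 smult_commute)
        finally show "a \<odot>\<^bsub>M\<^esub> x = \<zero>\<^bsub>M\<^esub>" using Ann_D[OF ae x] by simp
      qed
    qed
    then have "orth L N" if "submod N" for N using orth_if_residual_in_Ann L(1) that by blast
    moreover have "L \<noteq> smult_range f"
      using complementary_disjoint[OF ef L(2) order_refl] L F(3) submod_zero by blast
    ultimately show False
      using no_triangle[OF tf L(1) E(2) F(2)] L E F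
        complementary_orth[OF ef E(2) F(2) order_refl order_refl] by metis
  qed
  then show ?thesis using b by blast
qed

end

context module
begin

text \<open>
  The triangle consists of \<open>bM\<close>, \<open>cM\<close> and \<open>(b + c)M\<close>: the products \<open>b\<^sup>2\<close> and \<open>c\<^sup>2\<close> kill \<open>M\<close>, and \<open>bc = 0\<close>. The
  third submodule is different from the other two because its projections to \<open>eM\<close> and \<open>fM\<close> are both nonzero.
\<close>

lemma not_both_proper_socles:
  assumes tf: triangle_free and ef: "complementary e f"
    and b: "socle_generator e b" "smult_range b \<noteq> smult_range e"
    and c: "socle_generator f c" "smult_range c \<noteq> smult_range f"
  shows False
proof -
  note e = complementary_block_facts(1)[OF ef]
  note f = complementary_block_facts(1)[OF complementary_sym[OF ef]]
  note bR = socle_generatorD(1)[OF b(1)] and cR = socle_generatorD(1)[OF c(1)]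
  have bb: "b \<otimes> b \<in> Ann" and cc: "c \<otimes> c \<in> Ann"
    using socle_generator_square b c e f by blast+
  have "b \<otimes> c = (b \<otimes> e) \<otimes> (c \<otimes> f)" using socle_generatorD(3) b(1) c(1) by simp
  also have "\<dots> = (b \<otimes> c) \<otimes> (e \<otimes> f)" using bR cR e f by (simp only: m_ac m_closed)
  finally have bc0: "b \<otimes> c = \<zero>" using ef bR cR by (simp add: complementary_def)
  then have cb0: "c \<otimes> b = \<zero>" using bR cR by (simp add: m_comm)
  let ?s = "b \<oplus> c"
  have sR: "?s \<in> carrier R" using bR cR by simp
  have sb: "?s \<otimes> b \<in> Ann" and sc: "?s \<otimes> c \<in> Ann"
    using bb cc bc0 cb0 bR cR by (simp_all add: l_distr)
  have bc: "b \<otimes> c \<in> Ann" using bc0 by (simp add: Ann_I)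
  have B_sub: "smult_range b \<subseteq> smult_range e" and C_sub: "smult_range c \<subseteq> smult_range f"
    using socle_generator_range_subset b(1) c(1) e f by blast+
  \<comment> \<open>The projections of \<open>(b + c) x\<close> to the two blocks recover \<open>b x\<close> and \<open>c x\<close>.\<close>
  have e_s: "e \<odot>\<^bsub>M\<^esub> (?s \<odot>\<^bsub>M\<^esub> x) = b \<odot>\<^bsub>M\<^esub> x" "f \<odot>\<^bsub>M\<^esub> (?s \<odot>\<^bsub>M\<^esub> x) = c \<odot>\<^bsub>M\<^esub> x"
    if x: "x \<in> carrier M" for x
  proof -
    have "b \<odot>\<^bsub>M\<^esub> x \<in> smult_range e" "c \<odot>\<^bsub>M\<^esub> x \<in> smult_range f"
      using B_sub C_sub x by (auto simp: smult_range_def)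
    then show "e \<odot>\<^bsub>M\<^esub> (?s \<odot>\<^bsub>M\<^esub> x) = b \<odot>\<^bsub>M\<^esub> x" "f \<odot>\<^bsub>M\<^esub> (?s \<odot>\<^bsub>M\<^esub> x) = c \<odot>\<^bsub>M\<^esub> x"
      using smult_range_complementary[OF ef] smult_range_complementary[OF complementary_sym[OF ef]]
        x bR cR e f by (simp_all add: smult_l_distr smult_r_distr)
  qed
  have nB: "smult_range ?s \<noteq> smult_range b"
  proof
    assume eq: "smult_range ?s = smult_range b"
    have "c \<odot>\<^bsub>M\<^esub> x = \<zero>\<^bsub>M\<^esub>" if x: "x \<in> carrier M" for x
    proof -
      have "?s \<odot>\<^bsub>M\<^esub> x \<in> smult_range e" using eq B_sub x by (auto simp: smult_range_def)
      then show ?thesis using smult_range_complementary(2)[OF ef] e_s(2)[OF x] by simp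
    qed
    then show False using socle_generatorD(2)[OF c(1)] Ann_I cR by blast
  qed
  have nC: "smult_range ?s \<noteq> smult_range c"
  proof
    assume eq: "smult_range ?s = smult_range c"
    have "b \<odot>\<^bsub>M\<^esub> x = \<zero>\<^bsub>M\<^esub>" if x: "x \<in> carrier M" for x
    proof -
      have "?s \<odot>\<^bsub>M\<^esub> x \<in> smult_range f" using eq C_sub x by (auto simp: smult_range_def)
      then show ?thesis
        using smult_range_complementary(2)[OF complementary_sym[OF ef]] e_s(1)[OF x] by simp
    qed
    then show False using socle_generatorD(2)[OF b(1)] Ann_I bR by blast
  qed
  have B: "submod (smult_range b)" "smult_range b \<noteq> {\<zero>\<^bsub>M\<^esub>}"
    and C: "submod (smult_range c)" "smult_range c \<noteq> {\<zero>\<^bsub>M\<^esub>}" and S: "submod (smult_range ?s)"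
    using submod_smult_range smult_range_zero_iff bR cR sR socle_generatorD(2) b(1) c(1) by auto
  have nBC: "smult_range b \<noteq> smult_range c"
    using complementary_disjoint[OF ef B_sub C_sub] B submod_zero by auto
  have "smult_range ?s \<noteq> {\<zero>\<^bsub>M\<^esub>}"
  proof
    assume "smult_range ?s = {\<zero>\<^bsub>M\<^esub>}"
    then have "?s \<odot>\<^bsub>M\<^esub> x = \<zero>\<^bsub>M\<^esub>" if "x \<in> carrier M" for x
      using that by (auto simp: smult_range_def)
    then have "b \<odot>\<^bsub>M\<^esub> x = \<zero>\<^bsub>M\<^esub>" if "x \<in> carrier M" for x using e_s(1)[OF that] that e by simp
    then show False using socle_generatorD(2)[OF b(1)] Ann_I bR by blast
  qed
  then show False
    using no_triangle[OF tf S B(1) C(1)] B(2) C(2) nB nC nBC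
      orth_smult_ranges[OF sR bR sb] orth_smult_ranges[OF sR cR sc] orth_smult_ranges[OF bR cR bc]
    by blast
qed

text \<open>
  Another submodule that is non-trivial in \<open>fM\<close> would form a triangle with \<open>bM\<close> and \<open>eM\<close>.
\<close>

lemma proper_socle_unique_submodule:
  assumes tf: triangle_free and ef: "complementary e f"
    and b: "socle_generator f b" "smult_range b \<noteq> smult_range f"
    and L: "submod L" "L \<subseteq> smult_range f"
  shows "L = {\<zero>\<^bsub>M\<^esub>} \<or> L = smult_range b \<or> L = smult_range f"
proof (rule ccontr)
  assume not: "\<not> ?thesis"
  note E = complementary_block_facts[OF ef]
  note F = complementary_block_facts[OF complementary_sym[OF ef]]
  let ?B = "smult_range b"
  have B: "submod ?B" "?B \<noteq> {\<zero>\<^bsub>M\<^esub>}" "?B \<subseteq> smult_range f"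
    using submod_smult_range smult_range_zero_iff socle_generatorD(1,2)[OF b(1)]
      socle_generator_range_subset[OF b(1) F(1)] by auto
  have BL: "orth ?B L" using orth_socle[OF b(1) L(1)] L(2) not by blast
  have EB: "orth (smult_range e) ?B" and EL: "orth (smult_range e) L"
    using complementary_orth[OF ef E(2)] B L by auto
  have "smult_range e \<noteq> ?B" "smult_range e \<noteq> L"
    using complementary_disjoint[OF ef order_refl B(3)] complementary_disjoint[OF ef order_refl L(2)]
      E(3) submod_zero[OF E(2)] by auto
  then show False
    using no_triangle[OF tf E(2) B(1) L(1) E(3) B(2)] not EB EL BL by blast
qed

lemma star_graph_if_two_simple_blocks:
  assumes tf: triangle_free and ef: "complementary e f"
    and simple: "simple_submod (smult_range e)" "simple_submod (smult_range f)"
  shows "star_graph (AG R M)"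
proof -
  note fe = complementary_sym[OF ef]
  note E = complementary_block_facts[OF ef] and F = complementary_block_facts[OF fe]
  note subs = submods_of_two_simple_blocks[OF ef simple]
  let ?E = "smult_range e" and ?F = "smult_range f"
  have e: "e \<in> res ?E" "e \<notin> Ann" and f: "f \<in> res ?F" "f \<notin> Ann"
    using ef in_res_smult_range by (auto simp: complementary_def)
  have M_no: "carrier M \<notin> AG_verts R M"
  proof
    assume "carrier M \<in> AG_verts R M"
    then obtain K where K: "nontrivial_submodule K R M" "orth (carrier M) K"
      using nontrivial_submodule_if_AG_vert by blast
    then have "K = ?E \<or> K = ?F" using subs unfolding nontrivial_submodule_def by blast
    then show False
      using K(2) not_orth_carrier[OF E(2) e] not_orth_carrier[OF F(2) f] by blast
  qed
  have EF: "orth ?E ?F" using complementary_orth[OF ef E(2) F(2)] by simp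
  show ?thesis
  proof (rule star_graph_if_center[OF tf])
    show "?E \<in> AG_verts R M" using AG_vertI[OF E(2,3) F(2-4) EF] .
    show "orth ?E N" if "N \<in> AG_verts R M" "N \<noteq> ?E" for N
    proof -
      have "submod N" "N \<noteq> {\<zero>\<^bsub>M\<^esub>}" using that(1) by (auto simp: AG_verts_def)
      then have "N = ?F" using subs M_no that by blast
      then show ?thesis using EF by simp
    qed
  qed
qed

text \<open>
  The only non-trivial submodules are \<open>eM\<close> and \<open>fM\<close>, so \<open>S\<close> is one of them and has no room for \<open>N\<close>.
\<close>

lemma two_simple_blocks_no_direct_sum:
  assumes ef: "complementary e f"
    and simple: "simple_submod (smult_range e)" "simple_submod (smult_range f)"
  shows "\<not> direct_sum_with_chain F S N"
proof
  assume "direct_sum_with_chain F S N"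
  then have sub: "submod F" "submod S" "submod N"
    and ne: "F \<noteq> {\<zero>\<^bsub>M\<^esub>}" "N \<noteq> {\<zero>\<^bsub>M\<^esub>}" "N \<subset> S" and disj: "F \<inter> S = {\<zero>\<^bsub>M\<^esub>}"
    by (simp_all add: direct_sum_with_chain_def)
  have "S \<noteq> carrier M" using disj ne(1) submoduleE(1)[OF sub(1)] by blast
  moreover have "S \<noteq> {\<zero>\<^bsub>M\<^esub>}" using ne(2,3) submod_zero[OF sub(3)] by blast
  ultimately have "S = smult_range e \<or> S = smult_range f"
    using submods_of_two_simple_blocks[OF ef simple sub(2)] by blast
  then have "simple_submod S" using simple by blast
  then show False using sub(3) ne(2,3) unfolding simple_submod_def by blast
qed

text \<open>
  The non-trivial submodules are \<open>fM\<close>, \<open>eM\<close>, \<open>bM\<close> and \<open>eM + bM\<close>, and consecutive ones in this order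
  have product zero. The other pairs are not adjacent, and \<open>M\<close> is not a vertex, because
  suitable products of \<open>1\<close>, \<open>e\<close>, \<open>f\<close> and \<open>b\<close> from the residuals do not kill \<open>M\<close>.
\<close>

lemma path_4_if_simple_and_proper_socle:
  assumes tf: triangle_free and ef: "complementary e f"
    and simple: "simple_submod (smult_range e)"
    and b: "socle_generator f b" "smult_range b \<noteq> smult_range f"
  shows "digraph_iso (with_proj (AG R M)) (with_proj (path_graph 4))"
proof -
  note fe = complementary_sym[OF ef]
  note E = complementary_block_facts[OF ef] and F = complementary_block_facts[OF fe]
  note ints = complementary_carrier_components[OF ef] complementary_carrier_components[OF fe]
  note bR = socle_generatorD(1)[OF b(1)]
  let ?E = "smult_range e" and ?F = "smult_range f" and ?B = "smult_range b"
  \<comment> \<open>The submodule \<open>eM + bM\<close>, described by the second component of its elements.\<close>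
  define D where "D = {x \<in> carrier M. f \<odot>\<^bsub>M\<^esub> x \<in> ?B}"
  have B: "submod ?B" "?B \<noteq> {\<zero>\<^bsub>M\<^esub>}" "?B \<subseteq> ?F" "?B \<noteq> ?F"
    using submod_smult_range smult_range_zero_iff socle_generatorD(1,2)[OF b(1)]
      socle_generator_range_subset[OF b(1) F(1)] b(2) by auto
  have D: "submod D"
    using B(1) F(1) unfolding D_def submodule_iff
    by (auto simp: smult_r_distr smult_commute[of f])
  have BE: "?B \<inter> ?E = {\<zero>\<^bsub>M\<^esub>}" and BF: "?B \<inter> ?F = ?B"
    using ints(6) B(3) submod_zero[OF B(1)] submod_zero[OF E(2)] by blast+
  have DE: "D \<inter> ?E = ?E"
    using smult_range_complementary(2)[OF ef] submod_subset[OF E(2)] submod_zero[OF B(1)]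
    by (auto simp: D_def)
  have DF: "D \<inter> ?F = ?B"
    using smult_range_complementary(1)[OF fe] submod_subset[OF B(1)] B(3) by (auto simp: D_def)
  have subs: "N = {\<zero>\<^bsub>M\<^esub>} \<or> N = ?F \<or> N = ?E \<or> N = ?B \<or> N = D \<or> N = carrier M" if N: "submod N" for N
  proof -
    have "N \<inter> ?E = {\<zero>\<^bsub>M\<^esub>} \<or> N \<inter> ?E = ?E"
      using simple submod_Int[OF N E(2)] unfolding simple_submod_def by blast
    moreover have "N \<inter> ?F = {\<zero>\<^bsub>M\<^esub>} \<or> N \<inter> ?F = ?B \<or> N \<inter> ?F = ?F"
      using proper_socle_unique_submodule[OF tf ef b submod_Int[OF N F(2)]] by blast
    ultimately show ?thesis
      using submod_eq_if_components_eq[OF ef N] ints submod_of_zero carrier_is_submodule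
        E(2) F(2) B(1) D BE BF DE DF
      by (metis inf_idem)
  qed
  have res: "e \<in> res ?E" "f \<in> res ?F" "b \<in> res ?B" "e \<in> res D" "b \<in> res D"
  proof -
    show "e \<in> res ?E" "f \<in> res ?F" "b \<in> res ?B" using in_res_smult_range E(1) F(1) bR by auto
    have "?E \<subseteq> D" "?B \<subseteq> D" using DE DF by blast+
    then show "e \<in> res D" "b \<in> res D" using E(1) bR by (auto simp: residual_def smult_range_def)
  qed
  have notin: "e \<notin> Ann" "f \<notin> Ann" "b \<notin> Ann" "e \<otimes> e \<notin> Ann" "f \<otimes> b \<notin> Ann"
    using ef socle_generatorD(2,3)[OF b(1)] bR by (auto simp: complementary_def m_comm[of f b])
  have not_FD: "\<not> ?F \<subseteq> D" using DF B(4) by blast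
  have D_ne: "D \<noteq> {\<zero>\<^bsub>M\<^esub>}" "D \<noteq> carrier M"
    using DE ints(1) E(3) not_FD submoduleE(1)[OF F(2)] by metis+
  have ne: "?F \<noteq> ?E" "?F \<noteq> ?B" "?F \<noteq> D" "?E \<noteq> ?B" "?E \<noteq> D" "?B \<noteq> D"
    using E(3,5) B(2,4) BE DE DF not_FD ints(3) by (metis inf_idem order_refl)+
  have B_ne: "?B \<noteq> carrier M" using BE ints(2) E(3) by metis
  have FE: "orth ?F ?E" and EB: "orth ?E ?B"
    using complementary_orth[OF fe F(2) E(2)] complementary_orth[OF ef E(2) B(1)] B(3) by auto
  have BD: "orth ?B D" using orth_socle[OF b(1) D not_FD] .
  have orth': "orth ?E ?F" "orth ?B ?E" "orth D ?B"
    using orth_sym[OF F(2) E(2) FE] orth_sym[OF E(2) B(1) EB] orth_sym[OF B(1) D BD] by auto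
  have not_orth: "\<not> orth ?F ?B" "\<not> orth ?F D" "\<not> orth ?E D"
    using not_orthI[OF F(2) B(1) res(2,3)] not_orthI[OF F(2) D res(2,5)]
      not_orthI[OF E(2) D res(1,4)] notin by blast+
  have not_orth': "\<not> orth ?B ?F" "\<not> orth D ?F" "\<not> orth D ?E"
    using not_orth orth_sym[OF B(1) F(2)] orth_sym[OF D F(2)] orth_sym[OF D E(2)] by blast+
  have M_no: "carrier M \<notin> AG_verts R M"
  proof
    assume "carrier M \<in> AG_verts R M"
    then obtain K where K: "nontrivial_submodule K R M" "orth (carrier M) K"
      using nontrivial_submodule_if_AG_vert by blast
    then have "K = ?F \<or> K = ?E \<or> K = ?B \<or> K = D" using subs unfolding nontrivial_submodule_def by blast
    then show False
      using K(2) not_orth_carrier[OF F(2) res(2)] not_orth_carrier[OF E(2) res(1)]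
        not_orth_carrier[OF B(1) res(3)] not_orth_carrier[OF D res(4)] notin by blast
  qed
  have verts_in: "?F \<in> AG_verts R M" "?E \<in> AG_verts R M" "?B \<in> AG_verts R M" "D \<in> AG_verts R M"
    using AG_vertI[OF F(2,3) E(2-4) FE] AG_vertI[OF E(2,3) F(2-4) orth'(1)]
      AG_vertI[OF B(1,2) E(2-4) orth'(2)] AG_vertI[OF D D_ne(1) B(1,2) B_ne orth'(3)] by auto
  have verts: "AG_verts R M = {?F, ?E, ?B, D}"
  proof
    show "AG_verts R M \<subseteq> {?F, ?E, ?B, D}"
    proof
      fix N assume N: "N \<in> AG_verts R M"
      then have "submod N" "N \<noteq> {\<zero>\<^bsub>M\<^esub>}" by (auto simp: AG_verts_def)
      then show "N \<in> {?F, ?E, ?B, D}" using subs M_no N by blast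
    qed
  qed (use verts_in in simp)
  have arcs: "parcs (AG R M) = {(?F, ?E), (?E, ?F), (?E, ?B), (?B, ?E), (?B, D), (D, ?B)}"
  proof (rule subset_antisym; rule subrelI)
    fix N K assume "(N, K) \<in> parcs (AG R M)"
    then have "N \<in> {?F, ?E, ?B, D}" "K \<in> {?F, ?E, ?B, D}" "N \<noteq> K" "orth N K"
      by (simp_all add: AG_def verts)
    then show "(N, K) \<in> {(?F, ?E), (?E, ?F), (?E, ?B), (?B, ?E), (?B, D), (D, ?B)}"
      using not_orth not_orth' by (elim insertE emptyE; simp)
  next
    fix N K assume "(N, K) \<in> {(?F, ?E), (?E, ?F), (?E, ?B), (?B, ?E), (?B, D), (D, ?B)}"
    then show "(N, K) \<in> parcs (AG R M)"
      using FE EB BD orth' ne ne[symmetric] by (elim insertE emptyE; simp add: AG_def verts)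
  qed
  show ?thesis
    by (rule digraph_iso_path_4I[of _ ?F ?E ?B D])
      (use verts arcs ne in \<open>simp_all add: AG_def\<close>)
qed

end

section \<open>Products of modules\<close>

context artinian_module
begin

text \<open>
  A submodule as a module in its own right. The record is built anew instead of updating the
  carrier of \<open>M\<close>, in order to drop the extension fields from its type.
\<close>

definition module_on :: "'c set \<Rightarrow> ('a, 'c) module" where
  "module_on N = \<lparr>carrier = N, mult = mult M, one = one M, zero = zero M, add = add M, smult = smult M\<rparr>"

lemma module_on_simps [simp]:
  "carrier (module_on N) = N" "\<zero>\<^bsub>module_on N\<^esub> = \<zero>\<^bsub>M\<^esub>"
  "x \<oplus>\<^bsub>module_on N\<^esub> y = x \<oplus>\<^bsub>M\<^esub> y" "a \<odot>\<^bsub>module_on N\<^esub> x = a \<odot>\<^bsub>M\<^esub> x"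
  by (simp_all add: module_on_def)

lemma module_on_module:
  assumes N: "submod N" shows "Module.module R (module_on N)"
proof (rule moduleI)
  show "abelian_group (module_on N)"
  proof (rule abelian_groupI)
    fix x assume "x \<in> carrier (module_on N)"
    then show "\<exists>y\<in>carrier (module_on N). y \<oplus>\<^bsub>module_on N\<^esub> x = \<zero>\<^bsub>module_on N\<^esub>"
      using submoduleE(3)[OF N, of x] submod_subset[OF N, of x]
      by (intro bexI[of _ "\<ominus>\<^bsub>M\<^esub> x"]) (simp_all add: M.l_neg)
  qed (use submod_subset[OF N] submoduleE(5)[OF N] submod_zero[OF N] in
      \<open>auto simp: M.a_assoc M.a_comm M.a_lcomm\<close>)
qed (use submod_subset[OF N] submoduleE(4)[OF N] R.is_cring in
    \<open>auto simp: smult_l_distr smult_r_distr smult_assoc1\<close>)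

lemma submodule_module_on_iff:
  assumes N: "submod N" shows "submodule L R (module_on N) \<longleftrightarrow> submod L \<and> L \<subseteq> N"
  unfolding module.submodule_iff[OF module_on_module[OF N]] submodule_iff
  using submod_subset[OF N] by auto

lemma complementary_module_isomorphic:
  assumes ef: "complementary e f"
  shows "module_isomorphic R M (module_DirProd (module_on (smult_range e)) (module_on (smult_range f)))"
proof -
  note fe = complementary_sym[OF ef]
  have R: "e \<in> carrier R" "f \<in> carrier R" using ef by (auto simp: complementary_def)
  let ?P = "module_DirProd (module_on (smult_range e)) (module_on (smult_range f))"
  let ?h = "\<lambda>x. (e \<odot>\<^bsub>M\<^esub> x, f \<odot>\<^bsub>M\<^esub> x)"
  have "?h \<in> hom (add_monoid M) (add_monoid ?P)"
    using R by (auto simp: hom_def module_DirProd_def smult_range_def smult_r_distr)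
  moreover have "bij_betw ?h (carrier M) (smult_range e \<times> smult_range f)"
  proof (rule bij_betw_byWitness[where f' = "\<lambda>(u, v). u \<oplus>\<^bsub>M\<^esub> v"])
    show "\<forall>x\<in>carrier M. (\<lambda>(u, v). u \<oplus>\<^bsub>M\<^esub> v) (?h x) = x"
      using complementary_smult(4)[OF ef] by simp
    have "u \<in> carrier M \<and> v \<in> carrier M \<and> e \<odot>\<^bsub>M\<^esub> (u \<oplus>\<^bsub>M\<^esub> v) = u \<and> f \<odot>\<^bsub>M\<^esub> (u \<oplus>\<^bsub>M\<^esub> v) = v"
      if uv: "u \<in> smult_range e" "v \<in> smult_range f" for u v
    proof -
      have "u \<in> carrier M" "v \<in> carrier M"
        using uv R by (auto simp: smult_range_def)
      then show ?thesis
        using uv R smult_range_complementary[OF ef] smult_range_complementary[OF fe]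
        by (simp add: smult_r_distr)
    qed
    then show "\<forall>p\<in>smult_range e \<times> smult_range f. ?h ((\<lambda>(u, v). u \<oplus>\<^bsub>M\<^esub> v) p) = p"
      "(\<lambda>(u, v). u \<oplus>\<^bsub>M\<^esub> v) ` (smult_range e \<times> smult_range f) \<subseteq> carrier M"
      by auto
  qed (auto simp: smult_range_def)
  ultimately have h_iso: "?h \<in> iso (add_monoid M) (add_monoid ?P)"
    by (simp add: iso_def module_DirProd_def)
  have "?h (a \<odot>\<^bsub>M\<^esub> x) = a \<odot>\<^bsub>?P\<^esub> ?h x" if "a \<in> carrier R" "x \<in> carrier M" for a x
    using that R by (simp add: module_DirProd_def smult_commute)
  then show ?thesis unfolding module_isomorphic_def by - (rule bexI[OF _ h_iso], simp)
qed

lemma ex_simple_times_unique_submodule: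
  assumes tf: triangle_free and ef: "complementary e f"
    and simple: "simple_submod (smult_range e)"
    and b: "socle_generator f b" "smult_range b \<noteq> smult_range f"
  shows "\<exists>(F :: ('a, 'c) module) (S :: ('a, 'c) module). simple_module R F \<and> Module.module R S \<and>
    (\<exists>!N. nontrivial_submodule N R S) \<and> module_isomorphic R M (module_DirProd F S)"
proof (intro exI conjI)
  note E = complementary_block_facts[OF ef] and F = complementary_block_facts[OF complementary_sym[OF ef]]
  show "simple_module R (module_on (smult_range e))"
    using simple module_on_module[OF E(2)]
    by (simp add: simple_module_def simple_submod_def submodule_module_on_iff[OF E(2)])
  show "Module.module R (module_on (smult_range f))" by (rule module_on_module[OF F(2)])
  show "module_isomorphic R M (module_DirProd (module_on (smult_range e)) (module_on (smult_range f)))"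
    by (rule complementary_module_isomorphic[OF ef])
  have "nontrivial_submodule N R (module_on (smult_range f)) \<longleftrightarrow> N = smult_range b" for N
    using submod_smult_range smult_range_zero_iff socle_generatorD(1,2)[OF b(1)] b(2)
      socle_generator_range_subset[OF b(1) F(1)] proper_socle_unique_submodule[OF tf ef b, of N]
    by (auto simp: nontrivial_submodule_def submodule_module_on_iff[OF F(2)])
  then show "\<exists>!N. nontrivial_submodule N R (module_on (smult_range f))" by simp
qed

text \<open>
  The preimages of \<open>F \<times> 0\<close>, \<open>0 \<times> S\<close> and \<open>0 \<times> N\<close> under the isomorphism.
\<close>

lemma direct_product_submodules:
  fixes F S :: "('a, 'e) module"
  assumes "Module.module R F" "Module.module R S"
    and F_ne: "carrier F \<noteq> {\<zero>\<^bsub>F\<^esub>}" and N: "nontrivial_submodule N R S"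
    and iso: "module_isomorphic R M (module_DirProd F S)"
  shows "\<exists>F' S' N'. direct_sum_with_chain F' S' N'"
proof -
  interpret F: module R F by fact
  interpret S: module R S by fact
  obtain h where h_iso: "h \<in> iso (add_monoid M) (add_monoid (module_DirProd F S))"
    and h_smult: "\<And>a x. a \<in> carrier R \<Longrightarrow> x \<in> carrier M \<Longrightarrow> h (a \<odot>\<^bsub>M\<^esub> x) = a \<odot>\<^bsub>module_DirProd F S\<^esub> h x"
    using iso unfolding module_isomorphic_def by blast
  have bij: "bij_betw h (carrier M) (carrier F \<times> carrier S)"
    and h_add: "\<And>x y. x \<in> carrier M \<Longrightarrow> y \<in> carrier M \<Longrightarrow>
      h (x \<oplus>\<^bsub>M\<^esub> y) = (fst (h x) \<oplus>\<^bsub>F\<^esub> fst (h y), snd (h x) \<oplus>\<^bsub>S\<^esub> snd (h y))"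
    using h_iso by (auto simp: iso_def hom_def module_DirProd_def split_def)
  have h_smult: "h (a \<odot>\<^bsub>M\<^esub> x) = (a \<odot>\<^bsub>F\<^esub> fst (h x), a \<odot>\<^bsub>S\<^esub> snd (h x))"
    if "a \<in> carrier R" "x \<in> carrier M" for a x
    using h_smult[OF that] by (simp add: module_DirProd_def split_def)
  have h_in: "fst (h x) \<in> carrier F" "snd (h x) \<in> carrier S" if "x \<in> carrier M" for x
    using bij_betwE[OF bij] that by (auto simp: mem_Times_iff)
  have h_surj: "\<exists>x\<in>carrier M. h x = (u, v)" if "u \<in> carrier F" "v \<in> carrier S" for u v
  proof -
    have "(u, v) \<in> h ` carrier M" using that by (simp add: bij_betw_imp_surj_on[OF bij])
    then show ?thesis by (auto simp: image_iff dest: sym)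
  qed
  have h_inj: "x = y" if "x \<in> carrier M" "y \<in> carrier M" "h x = h y" for x y
    using bij that unfolding bij_betw_def inj_on_def by blast
  have h_zero: "h \<zero>\<^bsub>M\<^esub> = (\<zero>\<^bsub>F\<^esub>, \<zero>\<^bsub>S\<^esub>)"
    using h_smult[of \<zero> "\<zero>\<^bsub>M\<^esub>"] h_in[of "\<zero>\<^bsub>M\<^esub>"] by simp
  define pre where "pre A C = {x \<in> carrier M. fst (h x) \<in> A \<and> snd (h x) \<in> C}" for A C
  have sub_pre: "submod (pre A C)" if "submodule A R F" "submodule C R S" for A C
    using that unfolding pre_def submodule_iff F.submodule_iff S.submodule_iff
    by (auto simp: h_add h_smult h_zero)
  have zero_sub: "submodule {\<zero>\<^bsub>F\<^esub>} R F" "submodule {\<zero>\<^bsub>S\<^esub>} R S"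
    by (simp_all add: F.submodule_iff S.submodule_iff)
  have N_sub: "submodule N R S" "N \<noteq> {\<zero>\<^bsub>S\<^esub>}" "N \<noteq> carrier S"
    using N by (auto simp: nontrivial_submodule_def)
  have N_props: "N \<subseteq> carrier S" "\<zero>\<^bsub>S\<^esub> \<in> N" using N_sub(1) by (auto simp: S.submodule_iff)
  let ?F = "pre (carrier F) {\<zero>\<^bsub>S\<^esub>}" and ?S = "pre {\<zero>\<^bsub>F\<^esub>} (carrier S)" and ?N = "pre {\<zero>\<^bsub>F\<^esub>} N"
  have "direct_sum_with_chain ?F ?S ?N"
    unfolding direct_sum_with_chain_def
  proof (intro conjI ballI)
    show "submod ?F" "submod ?S" "submod ?N"
      using sub_pre zero_sub N_sub(1) F.carrier_is_submodule S.carrier_is_submodule by auto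
    obtain u where u: "u \<in> carrier F" "u \<noteq> \<zero>\<^bsub>F\<^esub>" using F_ne F.zero_closed by blast
    then obtain x where "x \<in> carrier M" "h x = (u, \<zero>\<^bsub>S\<^esub>)" using h_surj by blast
    then have "x \<in> ?F" "x \<noteq> \<zero>\<^bsub>M\<^esub>" using u h_zero by (auto simp: pre_def)
    then show "?F \<noteq> {\<zero>\<^bsub>M\<^esub>}" by blast
    obtain v where v: "v \<in> N" "v \<noteq> \<zero>\<^bsub>S\<^esub>" using N_sub(2) N_props by blast
    then obtain y where "y \<in> carrier M" "h y = (\<zero>\<^bsub>F\<^esub>, v)" using h_surj N_props by blast
    then have "y \<in> ?N" "y \<noteq> \<zero>\<^bsub>M\<^esub>" using v h_zero by (auto simp: pre_def)
    then show "?N \<noteq> {\<zero>\<^bsub>M\<^esub>}" by blast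
    obtain w where w: "w \<in> carrier S" "w \<notin> N" using N_sub(3) N_props by blast
    then obtain z where "z \<in> carrier M" "h z = (\<zero>\<^bsub>F\<^esub>, w)" using h_surj by blast
    then have "z \<in> ?S" "z \<notin> ?N" using w by (auto simp: pre_def)
    moreover have "?N \<subseteq> ?S" using N_props by (auto simp: pre_def)
    ultimately show "?N \<subset> ?S" by blast
    show "?F \<inter> ?S = {\<zero>\<^bsub>M\<^esub>}"
    proof
      show "?F \<inter> ?S \<subseteq> {\<zero>\<^bsub>M\<^esub>}"
        using h_inj[OF _ M.zero_closed] h_zero by (auto simp: pre_def prod_eq_iff)
    qed (use h_zero in \<open>auto simp: pre_def\<close>)
    show "\<exists>u\<in>?F. \<exists>v\<in>?S. x = u \<oplus>\<^bsub>M\<^esub> v" if x: "x \<in> carrier M" for x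
    proof -
      obtain u v where uv: "u \<in> carrier M" "h u = (fst (h x), \<zero>\<^bsub>S\<^esub>)"
        "v \<in> carrier M" "h v = (\<zero>\<^bsub>F\<^esub>, snd (h x))"
        using h_surj h_in[OF x] F.zero_closed S.zero_closed by meson
      then have "h x = h (u \<oplus>\<^bsub>M\<^esub> v)" using h_in[OF x] by (simp add: h_add)
      then have "x = u \<oplus>\<^bsub>M\<^esub> v" using h_inj x uv by simp
      moreover have "u \<in> ?F" "v \<in> ?S" using uv h_in[OF x] by (simp_all add: pre_def)
      ultimately show ?thesis by blast
    qed
  qed
  then show ?thesis by blast
qed

end

section \<open>Classification of the bipartite graphs\<close>

context artinian_module
begin

text \<open>
  In each case of the proof exactly one of the two alternatives holds, namely a star without a product
  decomposition or the path with one. This gives both assertions, as a star is not isomorphic to the path.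
\<close>

lemma bipartite_AG_classification:
  assumes bip: "bipartite (AG R M)" and ne: "AG_verts R M \<noteq> {}"
  shows "(star_graph (AG R M) \<or> digraph_iso (with_proj (AG R M)) (with_proj (path_graph 4))) \<and>
    (digraph_iso (with_proj (AG R M)) (with_proj (path_graph 4)) \<longleftrightarrow>
      (\<exists>(F :: ('a, 'c) module) (S :: ('a, 'c) module).
        simple_module R F \<and> Module.module R S \<and> (\<exists>!N. nontrivial_submodule N R S) \<and>
        module_isomorphic R M (module_DirProd F S)))"
    (is "(?star \<or> ?path) \<and> (?path \<longleftrightarrow> ?product)")
proof -
  have tf: triangle_free using triangle_free_if_bipartite[OF bip] .
  have not_product: "\<not> ?product" if no_sum: "\<And>F' S' N'. \<not> direct_sum_with_chain F' S' N'"
  proof (intro notI, elim exE conjE ex1E)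
    fix F S :: "('a, 'c) module" and N
    assume F: "simple_module R F" and S: "Module.module R S" "nontrivial_submodule N R S"
      and iso: "module_isomorphic R M (module_DirProd F S)"
    have F': "Module.module R F" "carrier F \<noteq> {\<zero>\<^bsub>F\<^esub>}"
      using F by (simp_all add: simple_module_def)
    show False using direct_product_submodules[OF F'(1) S(1) F'(2) S(2) iso] no_sum by blast
  qed
  have "?star \<and> \<not> ?product \<or> ?path \<and> ?product"
  proof (cases "primitive \<one>")
    case True
    have "\<not> ?product" using one_primitive_no_direct_sum[OF tf True] by (rule not_product)
    then show ?thesis using star_graph_if_one_primitive[OF tf True ne] by blast
  next
    case False
    have "\<one> \<notin> Ann"
    proof
      assume one: "\<one> \<in> Ann"
      obtain N where "submod N" "N \<noteq> {\<zero>\<^bsub>M\<^esub>}" using ne by (auto simp: AG_verts_def)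
      then obtain x where "x \<in> carrier M" "x \<noteq> \<zero>\<^bsub>M\<^esub>" using submod_zero submod_subset by blast
      then show False using Ann_D[OF one] by simp
    qed
    then obtain e f where ef: "complementary e f"
      using ex_complementary_if_one_not_primitive False by blast
    note fe = complementary_sym[OF ef]
    consider (simple) "simple_submod (smult_range e)" "simple_submod (smult_range f)"
      | (right) b where "simple_submod (smult_range e)" "socle_generator f b" "smult_range b \<noteq> smult_range f"
      | (left) b where "simple_submod (smult_range f)" "socle_generator e b" "smult_range b \<noteq> smult_range e"
      using block_simple_or_proper_socle[OF tf ef] block_simple_or_proper_socle[OF tf fe]
        not_both_proper_socles[OF tf ef] by blast
    then show ?thesis
    proof cases
      case simple
      have "\<not> ?product" using two_simple_blocks_no_direct_sum[OF ef simple] by (rule not_product)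
      then show ?thesis using star_graph_if_two_simple_blocks[OF tf ef simple] by blast
    next
      case right
      then show ?thesis
        using path_4_if_simple_and_proper_socle[OF tf ef] ex_simple_times_unique_submodule[OF tf ef]
        by blast
    next
      case left
      then show ?thesis
        using path_4_if_simple_and_proper_socle[OF tf fe] ex_simple_times_unique_submodule[OF tf fe]
        by blast
    qed
  qed
  then show ?thesis using star_graph_not_iso_path_4 by blast
qed

end

theorem theorem2p8:
  fixes R :: "('a, 'b) ring_scheme" and M :: "('a, 'c, 'd) module_scheme"
  assumes "artinian_cring R" and "\<one>\<^bsub>R\<^esub> \<noteq> \<zero>\<^bsub>R\<^esub>"
    and "Module.module R M"
    and "pverts (AG R M) \<noteq> {}"
    and "bipartite (AG R M)"
  shows "(star_graph (AG R M) \<or> digraph_iso (with_proj (AG R M)) (with_proj (path_graph 4))) \<and>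
    (digraph_iso (with_proj (AG R M)) (with_proj (path_graph 4)) \<longleftrightarrow>
      (\<exists>(F :: ('a, 'c) module) (S :: ('a, 'c) module).
        simple_module R F \<and> Module.module R S \<and> (\<exists>!N. nontrivial_submodule N R S) \<and>
        module_isomorphic R M (module_DirProd F S)))"
proof -
  interpret module R M by fact
  interpret artinian_cring R by fact
  interpret artinian_module R M ..
  have "AG_verts R M \<noteq> {}" using assms(4) by (simp add: AG_def)
  with assms(5) show ?thesis by (rule bipartite_AG_classification)
qed

end
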